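(* For a rational number $y\in\mathbb{Q}$, the following two statements are equivalent: (i) $C(y)\ge \frac13$. (ii) $y$ is either a Markov fraction or a companion of a Markov fraction. Furthermore, $C(y)=\frac13$ if and only if $y$ is a first left or first right companion of a Markov fraction, i.e. $y=\gamma_2^{+}\big(\frac pq\big)$ or $y=\gamma_2^{-}\big(\frac pq\big)$ for some Markov fraction $\frac pq$.
   Context: For $x\in\mathbb{R}$ the approximation constant is $C(x)=\inf_{\frac ab\in\mathbb{Q}\setminus\{x\}} b^2\,\big|x-\frac ab\big|$. A Markov triple is a triple $(q_1,q_2,q_3)$ of positive integers with $q_1^2+q_2^2+q_3^2=3q_1q_2q_3$. A triple of rational numbers $(x_1,x_2,x_3)$ is a rational Markov triple if $x_k=\frac{p_k}{q_k}$ for some Markov triple $(q_1,q_2,q_3)$ and some integers $p_1,p_2,p_3$ satisfying $p_2q_1-p_1q_2=q_3$ and $p_3q_2-p_2q_3=q_1$. (Then the fractions $\frac{p_k}{q_k}$ are automatically reduced.) A Markov fraction is a rational number that is an element of some rational Markov triple. For a Markov fraction $\frac pq$ (reduced, $q>0$), define the integer sequence $(u_k)_{k\ge 0}$ by $u_0=0$, $u_1=1$, $u_{k+1}=3q\,u_k-u_{k-1}$. The right and left companions of $\frac pq$ are the numbers $\gamma_k^{+}\big(\frac pq\big)=\frac pq+\frac{u_{k-1}}{q\,u_k}$ and $\gamma_k^{-}\big(\frac pq\big)=\frac pq-\frac{u_{k-1}}{q\,u_k}$, respectively, for $k\ge 2$. The first companions are those with $k=2$. *)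

theory Defs
  imports Complex_Main
begin

text \<open>
  Each rational is represented by its reduced fraction, so that the denominator is
  determined. The set is nonempty and bounded below by 0, so the real infimum is meaningful.
\<close>
definition approx_const :: "real \<Rightarrow> real" where
  "approx_const x =
    Inf {(of_int b)\<^sup>2 * \<bar>x - of_int a / of_int b\<bar> | a b :: int.
           b > 0 \<and> coprime a b \<and> x \<noteq> of_int a / of_int b}"

definition markov_triple :: "int \<Rightarrow> int \<Rightarrow> int \<Rightarrow> bool" where
  "markov_triple q1 q2 q3 \<longleftrightarrow>
    q1 > 0 \<and> q2 > 0 \<and> q3 > 0 \<and> q1\<^sup>2 + q2\<^sup>2 + q3\<^sup>2 = 3 * q1 * q2 * q3"

definition rational_markov_triple :: "rat \<Rightarrow> rat \<Rightarrow> rat \<Rightarrow> bool" where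
  "rational_markov_triple x1 x2 x3 \<longleftrightarrow>
    (\<exists>q1 q2 q3 p1 p2 p3 :: int.
       markov_triple q1 q2 q3 \<and>
       p2 * q1 - p1 * q2 = q3 \<and> p3 * q2 - p2 * q3 = q1 \<and>
       x1 = of_int p1 / of_int q1 \<and> x2 = of_int p2 / of_int q2 \<and> x3 = of_int p3 / of_int q3)"

definition markov_fraction :: "rat \<Rightarrow> bool" where
  "markov_fraction x \<longleftrightarrow>
    (\<exists>x1 x2 x3. rational_markov_triple x1 x2 x3 \<and> x \<in> {x1, x2, x3})"

fun companion_seq :: "int \<Rightarrow> nat \<Rightarrow> int" where
  "companion_seq q 0 = 0"
| "companion_seq q (Suc 0) = 1"
| "companion_seq q (Suc (Suc k)) = 3 * q * companion_seq q (Suc k) - companion_seq q k"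

definition reduced_denom :: "rat \<Rightarrow> int" where
  "reduced_denom x = snd (quotient_of x)"

text \<open>The companions of a Markov fraction are the values of the next two functions at \<open>k \<ge> 2\<close>.\<close>

definition right_companion :: "nat \<Rightarrow> rat \<Rightarrow> rat" where
  "right_companion k x =
    x + of_int (companion_seq (reduced_denom x) (k - 1)) /
        (of_int (reduced_denom x) * of_int (companion_seq (reduced_denom x) k))"

definition left_companion :: "nat \<Rightarrow> rat \<Rightarrow> rat" where
  "left_companion k x =
    x - of_int (companion_seq (reduced_denom x) (k - 1)) /
        (of_int (reduced_denom x) * of_int (companion_seq (reduced_denom x) k))"

definition companion_of :: "rat \<Rightarrow> rat \<Rightarrow> bool" where
  "companion_of y x \<longleftrightarrow> (\<exists>k\<ge>2. y = right_companion k x \<or> y = left_companion k x)"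

end

theory Submission
  imports Defs
begin

text \<open>
  Write \<open>y = a / b\<close>. Multiplying out, \<open>C(y) \<ge> 1/3\<close> says that \<open>b \<le> 3 d \<bar>a d - b c\<bar>\<close> for all
  fractions \<open>c / d \<noteq> y\<close>, a statement about integers only. The proof has three parts.

  \<^bold>\<open>Markov fractions are badly approximable.\<close> Read an integer vector \<open>(a, b)\<close> as the point
  \<open>a / b\<close> of the projective line, and measure a pair of vectors by its determinant. For a rational
  Markov triple, \<open>\<infinity> = (1, 0)\<close> together with the vectors of two neighbouring fractions spans an
  ideal triangle whose three determinants are the Markov numbers, and repeatedly rotating it by a half
  turn about its sides yields an ideal triangulation all of whose triangles have the same three
  determinants. The geodesic from \<open>\<infinity>\<close> to the Markov fraction \<open>p / q\<close> is one of its edges. So any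
  other fraction \<open>z\<close> lies to one side of it, and \<open>z\<close> is a vertex seen from that geodesic
  behind an edge of determinant \<open>\<gamma>\<close>, at determinants \<open>\<alpha>\<close> and \<open>\<beta>\<close> from its ends. Then the product of the
  determinants of \<open>z\<close> with \<open>\<infinity>\<close> and with \<open>p / q\<close> is at least \<open>\<alpha> \<beta> q / \<gamma>\<close>, and the Markov equation
  gives \<open>3 \<alpha> \<beta> > \<gamma>\<close>. This is \<open>frac_triple_bound\<close>.

  \<^bold>\<open>Companions.\<close> For \<open>x = p / q\<close> and a fraction \<open>z = a / b\<close> put \<open>D\<^sub>0 = b\<close>,
  \<open>D\<^sub>1 = a q - b p\<close>, \<open>D\<^sub>k\<^sub>+\<^sub>2 = 3 q D\<^sub>k\<^sub>+\<^sub>1 - D\<^sub>k\<close>. Then \<open>D\<^sub>k\<close> with \<open>k \<ge> 2\<close> is the determinant of \<open>z\<close>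
  with the \<open>k\<close>-th right companion of \<open>x\<close>. If the sign changes between \<open>D\<^sub>j = m\<close> and \<open>D\<^sub>j\<^sub>+\<^sub>1 = -n\<close>, then
  \<open>n \<equiv> p m\<close> modulo \<open>q\<close>, and the bound for the Markov fraction \<open>x\<close>, applied to a fraction of denominator
  \<open>m\<close>, gives \<open>3 m n > q\<close> unless \<open>n = 0\<close>, when \<open>z\<close> is itself a companion. This settles all \<open>z\<close> between
  \<open>x\<close> and the limit of its companions; for \<open>z < x\<close> the bound at \<open>x\<close> suffices. For \<open>z\<close>
  beyond that limit, some Markov fraction separates \<open>z\<close> from all the companions and is itself not too
  close to \<open>z\<close>. This is \<open>companion_bound_right\<close>.

  \<^bold>\<open>Nothing else.\<close> Between two consecutive companions every fraction is too close to one of the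
  two (\<open>gap_dichotomy\<close>). So if \<open>C(y) \<ge> 1/3\<close> and \<open>y\<close> is neither a Markov fraction nor a companion, then
  \<open>y\<close> lies beyond the companions of both outer fractions of a triple around it, hence within one of
  the two child triples in the Markov tree, and so on down the tree. But lying beyond the companions
  forces the outer denominators to be at most \<open>b\<^sup>2\<close> (\<open>outer_denominator_bound\<close>), while they grow
  along the descent. This is \<open>markov_tree_search\<close>.
\<close>

section \<open>Markov triples\<close>

lemma markov_triple_vieta_pos:
  assumes "markov_triple a b c" shows "c < 3 * a * b"
proof -
  have "c * (3 * a * b - c) = a\<^sup>2 + b\<^sup>2"
    using assms by (simp add: markov_triple_def power2_eq_square algebra_simps)
  moreover have "a\<^sup>2 + b\<^sup>2 > 0" using assms by (simp add: markov_triple_def sum_power2_gt_zero_iff)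
  ultimately have "0 < c * (3 * a * b - c)" by simp
  then have "0 < 3 * a * b - c" using assms unfolding markov_triple_def
    by (meson zero_less_mult_pos)
  then show ?thesis by simp
qed

lemma markov_triple_rotate: "markov_triple a b c \<Longrightarrow> markov_triple b c a"
  by (auto simp: markov_triple_def algebra_simps)

lemma markov_triple_swap: "markov_triple a b c \<Longrightarrow> markov_triple b a c"
  by (auto simp: markov_triple_def algebra_simps)

text \<open>
  For fixed \<open>a\<close> and \<open>b\<close> the Markov equation is quadratic in \<open>c\<close>, with roots of sum \<open>3 a b\<close>.
\<close>
lemma markov_triple_vieta:
  assumes "markov_triple a b c" shows "markov_triple a b (3 * a * b - c)"
  using assms markov_triple_vieta_pos[OF assms]
  by (simp add: markov_triple_def power2_eq_square algebra_simps)

text \<open>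
  At \<open>b\<close> the monic quadratic with roots \<open>c\<close> and \<open>3 a b - c\<close> is nonpositive, so \<open>b\<close> separates the roots:
  replacing the maximum of a Markov triple makes the triple smaller.
\<close>
lemma markov_vieta_le:
  assumes m: "markov_triple a b c" and "a \<le> b" "b < c"
  shows "3 * a * b - c \<le> b"
proof -
  have pos: "a \<ge> 1" "b \<ge> 1" using m by (auto simp: markov_triple_def)
  have "(c - b) * ((3 * a * b - c) - b) = a * a + 2 * (b * b) - 3 * a * (b * b)"
    using m by (simp add: markov_triple_def power2_eq_square algebra_simps)
  also have "\<dots> \<le> 0"
  proof -
    have "a * a \<le> a * (b * b)"
      using pos \<open>a \<le> b\<close> mult_left_mono[of 1 b b] by (intro mult_left_mono) linarith+
    moreover have "1 * (b * b) \<le> a * (b * b)" using pos by (intro mult_right_mono) auto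
    ultimately show ?thesis by linarith
  qed
  finally show ?thesis using \<open>b < c\<close> by (simp add: mult_le_0_iff)
qed

text \<open>
  By descent: replacing the maximal entry keeps the pairwise greatest common divisors. The descent
  stops only when the two largest entries agree, and then the triple is \<open>(1, 1, 1)\<close>.
\<close>
lemma markov_triple_coprime:
  "markov_triple a b c \<Longrightarrow> coprime a b \<and> coprime b c \<and> coprime a c"
proof (induction "nat (a + b + c)" arbitrary: a b c rule: less_induct)
  case less
  have *: "coprime x y \<and> coprime y z \<and> coprime x z"
    if m: "markov_triple x y z" and le: "x \<le> y" "y \<le> z" and sz: "x + y + z = a + b + c" for x y z
  proof (cases "y < z")
    case True
    let ?z = "3 * x * y - z"
    have m': "markov_triple x y ?z" by (rule markov_triple_vieta[OF m])
    have "?z \<le> y" by (rule markov_vieta_le[OF m le(1) True])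
    then have "nat (x + y + ?z) < nat (a + b + c)"
      using m m' sz True unfolding markov_triple_def by linarith
    from less.hyps[OF this m'] have c: "coprime x y" "coprime y ?z" "coprime x ?z" by auto
    have "gcd y z = gcd y ?z" "gcd x z = gcd x ?z"
      by (metis gcd_add_mult gcd_diff1 gcd.commute gcd_neg2 add.commute uminus_add_conv_diff mult.commute mult.assoc)+
    then show ?thesis using c by (simp add: coprime_iff_gcd_eq_1)
  next
    case False
    then have [simp]: "z = y" using le by simp
    have pos: "x \<ge> 1" "y \<ge> 1" using m by (auto simp: markov_triple_def)
    have "x * x = (3 * x - 2) * (y * y)" using m
      by (simp add: markov_triple_def power2_eq_square algebra_simps)
    moreover have "x * (y * y) \<le> (3 * x - 2) * (y * y)" using pos by (intro mult_right_mono) auto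
    ultimately have "x * (y * y) \<le> x * x" by simp
    then have "y * y \<le> x" using pos by simp
    moreover have "y * 1 \<le> y * y" using pos by (intro mult_left_mono) auto
    ultimately have "x = y" "y * y \<le> y * 1" using le by auto
    then have "x = 1" "y = 1" using pos by auto
    then show ?thesis by simp
  qed
  note m = less.prems
  note perms = m markov_triple_rotate[OF m] markov_triple_rotate[OF markov_triple_rotate[OF m]]
    markov_triple_swap[OF m] markov_triple_swap[OF markov_triple_rotate[OF m]]
    markov_triple_swap[OF markov_triple_rotate[OF markov_triple_rotate[OF m]]]
  consider "a \<le> b" "b \<le> c" | "b \<le> c" "c \<le> a" | "c \<le> a" "a \<le> b"
    | "b \<le> a" "a \<le> c" | "c \<le> b" "b \<le> a" | "a \<le> c" "c \<le> b" by linarith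
  then show ?case
    by cases (use perms *[of a b c] *[of b c a] *[of c a b] *[of b a c] *[of c b a] *[of a c b]
        in \<open>auto simp: coprime_commute\<close>)
qed

section \<open>Rational Markov triples\<close>

text \<open>
  Rational Markov triples with numerators and denominators kept apart, so that all
  computations below stay in the integers.
\<close>
definition frac_triple :: "int \<Rightarrow> int \<Rightarrow> int \<Rightarrow> int \<Rightarrow> int \<Rightarrow> int \<Rightarrow> bool" where
  "frac_triple p1 q1 p2 q2 p3 q3 \<longleftrightarrow>
     markov_triple q1 q2 q3 \<and> p2 * q1 - p1 * q2 = q3 \<and> p3 * q2 - p2 * q3 = q1"

lemma frac_triple_outer_det:
  assumes "frac_triple p1 q1 p2 q2 p3 q3"
  shows "p3 * q1 - p1 * q3 = 3 * q1 * q3 - q2"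
proof -
  have e: "p2 * q1 - p1 * q2 = q3" "p3 * q2 - p2 * q3 = q1" and q2: "q2 > 0"
    and m: "q1\<^sup>2 + q2\<^sup>2 + q3\<^sup>2 = 3 * q1 * q2 * q3"
    using assms by (auto simp: frac_triple_def markov_triple_def)
  have "q2 * (p3 * q1 - p1 * q3) = q1 * (p3 * q2 - p2 * q3) + q3 * (p2 * q1 - p1 * q2)"
    by (simp add: algebra_simps)
  also have "\<dots> = q2 * (3 * q1 * q3 - q2)"
    using e m by (simp add: power2_eq_square algebra_simps)
  finally show ?thesis using q2 by simp
qed

text \<open>
  The next two facts let any member of a triple be taken as its middle one: the fraction
  that leaves at one end returns at the other, translated by \<open>3\<close>.
\<close>
lemma frac_triple_rotate:
  assumes "frac_triple p1 q1 p2 q2 p3 q3"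
  shows "frac_triple p2 q2 p3 q3 (p1 + 3 * q1) q1"
  using assms frac_triple_outer_det[OF assms]
  by (auto simp: frac_triple_def algebra_simps dest: markov_triple_rotate)

lemma frac_triple_rotate_back:
  assumes "frac_triple p1 q1 p2 q2 p3 q3"
  shows "frac_triple (p3 - 3 * q3) q3 p1 q1 p2 q2"
  using assms frac_triple_outer_det[OF assms]
  by (auto simp: frac_triple_def algebra_simps intro: markov_triple_rotate)

lemma frac_triple_minus:
  assumes "frac_triple p1 q1 p2 q2 p3 q3"
  shows "frac_triple (- p3) q3 (- p2) q2 (- p1) q1"
  using assms by (auto simp: frac_triple_def markov_triple_def algebra_simps)

text \<open>
  The child triples are the two ways to go down in the Markov tree: \<open>v\<^sub>1\<close>, \<open>3 q\<^sub>1 v\<^sub>2 - v\<^sub>3\<close>, \<open>v\<^sub>2\<close> and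
  \<open>v\<^sub>2\<close>, \<open>3 q\<^sub>3 v\<^sub>2 - v\<^sub>1\<close>, \<open>v\<^sub>3\<close>, for the vectors \<open>v\<^sub>i = (p\<^sub>i, q\<^sub>i)\<close>.
\<close>
lemma frac_triple_left_child:
  assumes "frac_triple p1 q1 p2 q2 p3 q3"
  shows "frac_triple p1 q1 (3 * q1 * p2 - p3) (3 * q1 * q2 - q3) p2 q2"
proof -
  have m: "markov_triple q1 q2 q3" using assms by (simp add: frac_triple_def)
  have "markov_triple q1 (3 * q1 * q2 - q3) q2"
    using markov_triple_rotate[OF markov_triple_swap[OF markov_triple_vieta[OF m]]] 
      markov_triple_swap markov_triple_rotate by blast
  moreover have "(3 * q1 * p2 - p3) * q1 - p1 * (3 * q1 * q2 - q3) = q2"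
  proof -
    have "(3 * q1 * p2 - p3) * q1 - p1 * (3 * q1 * q2 - q3)
        = 3 * q1 * (p2 * q1 - p1 * q2) - (p3 * q1 - p1 * q3)" by (simp add: algebra_simps)
    then show ?thesis using assms frac_triple_outer_det[OF assms] by (simp add: frac_triple_def)
  qed
  moreover have "p2 * (3 * q1 * q2 - q3) - (3 * q1 * p2 - p3) * q2 = q1"
    using assms by (simp add: frac_triple_def algebra_simps)
  ultimately show ?thesis by (simp add: frac_triple_def)
qed

lemma frac_triple_right_child:
  assumes "frac_triple p1 q1 p2 q2 p3 q3"
  shows "frac_triple p2 q2 (3 * q3 * p2 - p1) (3 * q3 * q2 - q1) p3 q3"
  using frac_triple_minus[OF frac_triple_left_child[OF frac_triple_minus[OF assms]]]
  by (simp add: algebra_simps)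

text \<open>
  Modulo \<open>q\<close>, the determinant condition says \<open>p q\<^sub>1 \<equiv> q\<^sub>3\<close> and the Markov equation says
  \<open>q\<^sub>1\<^sup>2 + q\<^sub>3\<^sup>2 \<equiv> 0\<close>; cancel the unit \<open>q\<^sub>1\<^sup>2\<close>.
\<close>
lemma frac_triple_dvd_sq:
  assumes "frac_triple p1 q1 p q p3 q3" shows "q dvd p\<^sup>2 + 1"
proof -
  have e: "p * q1 = q3 + p1 * q" and m: "q1\<^sup>2 + q\<^sup>2 + q3\<^sup>2 = 3 * q1 * q * q3"
    and c: "coprime q q1"
    using assms markov_triple_coprime[of q1 q q3]
    by (auto simp: frac_triple_def markov_triple_def algebra_simps coprime_commute)
  have "q1\<^sup>2 * (p\<^sup>2 + 1) = (p * q1)\<^sup>2 + q1\<^sup>2" by (simp add: power2_eq_square algebra_simps)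
  also have "\<dots> = q * (3 * q1 * q3 - q + 2 * q3 * p1 + p1 * p1 * q)"
    using m unfolding e by (simp add: power2_eq_square algebra_simps)
  finally have "q dvd q1\<^sup>2 * (p\<^sup>2 + 1)" by simp
  then show ?thesis using c by (metis coprime_dvd_mult_right_iff coprime_power_right_iff)
qed

lemma frac_triple_coprime:
  assumes "frac_triple p1 q1 p q p3 q3" shows "coprime p q"
proof (rule coprimeI)
  fix d assume "d dvd p" "d dvd q"
  then have "d dvd p\<^sup>2" "d dvd p\<^sup>2 + 1"
    using frac_triple_dvd_sq[OF assms] by (auto simp: power2_eq_square intro: dvd_trans)
  then show "is_unit d" using dvd_add_right_iff by blast
qed

section \<open>The ideal triangulation and the bound for Markov fractions\<close>

text \<open>
  Two adjacent ideal triangles \<open>s, t, w\<close> and \<open>s, t, o\<close> with common edge \<open>s, t\<close>, where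
  \<open>s = (sa, sb)\<close> and so on. The determinants of the edges \<open>s t\<close>, \<open>t w\<close>, \<open>w s\<close> are \<open>\<gamma>\<close>, \<open>\<alpha>\<close>, \<open>\<beta>\<close>,
  and the half turn about \<open>s t\<close>, which maps \<open>(s, t)\<close> to \<open>(t, -s)\<close>, exchanges \<open>w\<close> and \<open>o\<close> up to sign.
  The vector \<open>o\<close> is determined by the others; it is carried along because the next vertices are integer
  combinations of \<open>o\<close>, \<open>s\<close> and \<open>t\<close>, which makes it evident that they are integer vectors.
\<close>
definition triangle_pair ::
  "int \<Rightarrow> int \<Rightarrow> int \<Rightarrow> int \<Rightarrow> int \<Rightarrow> int \<Rightarrow> int \<Rightarrow> int \<Rightarrow> int \<Rightarrow> int \<Rightarrow> int \<Rightarrow> bool" where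
  "triangle_pair \<gamma> \<alpha> \<beta> sa sb ta tb oa ob wa wb \<longleftrightarrow>
     markov_triple \<gamma> \<alpha> \<beta> \<and> ta * sb - sa * tb = \<gamma> \<and>
     \<gamma> * wa = \<alpha> * sa + \<beta> * ta \<and> \<gamma> * wb = \<alpha> * sb + \<beta> * tb \<and>
     \<gamma> * oa = \<beta> * sa - \<alpha> * ta \<and> \<gamma> * ob = \<beta> * sb - \<alpha> * tb"

lemma triangle_pair_dets:
  assumes "triangle_pair \<gamma> \<alpha> \<beta> sa sb ta tb oa ob wa wb"
  shows "wa * sb - sa * wb = \<beta>" "ta * wb - wa * tb = \<alpha>"
proof -
  have g: "\<gamma> > 0" using assms by (simp add: triangle_pair_def markov_triple_def)
  have D: "ta * sb - sa * tb = \<gamma>" and w: "\<gamma> * wa = \<alpha> * sa + \<beta> * ta" "\<gamma> * wb = \<alpha> * sb + \<beta> * tb"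
    using assms by (auto simp: triangle_pair_def)
  have "\<gamma> * (wa * sb - sa * wb) = (\<gamma> * wa) * sb - sa * (\<gamma> * wb)" by (simp add: algebra_simps)
  also have "\<dots> = \<beta> * (ta * sb - sa * tb)" unfolding w by (simp add: algebra_simps)
  finally show "wa * sb - sa * wb = \<beta>" using D g by simp
  have "\<gamma> * (ta * wb - wa * tb) = ta * (\<gamma> * wb) - (\<gamma> * wa) * tb" by (simp add: algebra_simps)
  also have "\<dots> = \<alpha> * (ta * sb - sa * tb)" unfolding w by (simp add: algebra_simps)
  finally show "ta * wb - wa * tb = \<alpha>" using D g by simp
qed

text \<open>
  One coordinate of the triangle beyond the edge \<open>s w\<close>: rotating about \<open>s w\<close> gives the third vertex
  \<open>(\<gamma> s + \<alpha> w) / \<beta>\<close>, and the Markov equation turns this into the integer vector \<open>3 \<alpha> s - o\<close>.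
\<close>
lemma triangle_pair_left_vec:
  fixes \<alpha> \<beta> \<gamma> s t w x :: int
  assumes m: "markov_triple \<gamma> \<alpha> \<beta>"
    and w: "\<gamma> * w = \<alpha> * s + \<beta> * t" and x: "\<gamma> * x = \<beta> * s - \<alpha> * t"
  shows "\<beta> * (3 * \<alpha> * s - x) = \<gamma> * s + \<alpha> * w"
proof -
  have e: "3 * \<gamma> * \<alpha> * \<beta> = \<gamma> * \<gamma> + \<alpha> * \<alpha> + \<beta> * \<beta>" and g: "\<gamma> > 0"
    using m by (auto simp: markov_triple_def power2_eq_square)
  have "\<gamma> * (\<beta> * (3 * \<alpha> * s - x)) = (3 * \<gamma> * \<alpha> * \<beta>) * s - \<beta> * (\<gamma> * x)" by (simp add: algebra_simps)
  also have "\<dots> = \<gamma> * \<gamma> * s + \<alpha> * (\<gamma> * w)" unfolding e w x by (simp add: algebra_simps)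
  finally have "\<gamma> * (\<beta> * (3 * \<alpha> * s - x)) = \<gamma> * (\<gamma> * s + \<alpha> * w)" by (simp add: algebra_simps)
  then show ?thesis using g by simp
qed

lemma triangle_pair_right_vec:
  fixes \<alpha> \<beta> \<gamma> s t w x :: int
  assumes m: "markov_triple \<gamma> \<alpha> \<beta>"
    and w: "\<gamma> * w = \<alpha> * s + \<beta> * t" and x: "\<gamma> * x = \<beta> * s - \<alpha> * t"
  shows "\<alpha> * (3 * \<beta> * t + x) = \<beta> * w + \<gamma> * t"
  using triangle_pair_left_vec[of \<gamma> \<beta> \<alpha> w t s "- x"] m w x
    markov_triple_rotate[OF markov_triple_swap[OF m]] markov_triple_swap[of \<gamma> \<alpha> \<beta>]
  by (auto simp: algebra_simps markov_triple_def)

text \<open>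
  Crossing the edge \<open>s w\<close>, respectively \<open>w t\<close>, leads to a triangle with the same determinants,
  cyclically permuted.
\<close>
lemma triangle_pair_left:
  assumes "triangle_pair \<gamma> \<alpha> \<beta> sa sb ta tb oa ob wa wb"
  shows "triangle_pair \<beta> \<gamma> \<alpha> sa sb wa wb (- ta) (- tb) (3 * \<alpha> * sa - oa) (3 * \<alpha> * sb - ob)"
  using assms triangle_pair_dets[OF assms]
    triangle_pair_left_vec[of \<gamma> \<alpha> \<beta> wa sa ta oa] triangle_pair_left_vec[of \<gamma> \<alpha> \<beta> wb sb tb ob]
  by (auto simp: triangle_pair_def markov_triple_def algebra_simps)

lemma triangle_pair_right:
  assumes "triangle_pair \<gamma> \<alpha> \<beta> sa sb ta tb oa ob wa wb"
  shows "triangle_pair \<alpha> \<beta> \<gamma> wa wb ta tb sa sb (3 * \<beta> * ta + oa) (3 * \<beta> * tb + ob)"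
  using assms triangle_pair_dets[OF assms]
    triangle_pair_right_vec[of \<gamma> \<alpha> \<beta> wa sa ta oa] triangle_pair_right_vec[of \<gamma> \<alpha> \<beta> wb sb tb ob]
  by (auto simp: triangle_pair_def markov_triple_def algebra_simps)

text \<open>
  Let \<open>X\<close> and \<open>Y\<close> denote the determinants of a vector with \<open>(1, 0)\<close> and with \<open>(p, q)\<close>. For
  \<open>\<gamma> z = i s + j t\<close> with \<open>s\<close> and \<open>t\<close> in the quadrant where both are nonnegative, \<open>\<gamma>\<^sup>2 X(z) Y(z)\<close> is at
  least \<open>i j (X(s) Y(t) + X(t) Y(s))\<close>, and this is at least \<open>i j\<close> times the difference
  \<open>X(s) Y(t) - X(t) Y(s) = q \<gamma>\<close>.
\<close>
lemma wedge_bound: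
  fixes p q :: int
  assumes q: "q > 0" and ij: "3 * (i * j) > \<gamma>" and i: "i > 0" and j: "j > 0" and g: "\<gamma> > 0"
    and D: "ta * sb - sa * tb = \<gamma>"
    and nn: "sb \<ge> 0" "tb \<ge> 0" "sa * q - sb * p \<ge> 0" "ta * q - tb * p \<ge> 0"
    and za: "\<gamma> * za = i * sa + j * ta" and zb: "\<gamma> * zb = i * sb + j * tb"
  shows "q < 3 * zb * (za * q - zb * p)"
proof -
  define sy where "sy = sa * q - sb * p"
  define ty where "ty = ta * q - tb * p"
  have zy: "\<gamma> * (za * q - zb * p) = i * sy + j * ty"
  proof -
    have "\<gamma> * (za * q - zb * p) = (\<gamma> * za) * q - (\<gamma> * zb) * p" by (simp add: algebra_simps)
    then show ?thesis unfolding za zb sy_def ty_def by (simp add: algebra_simps)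
  qed
  have D': "sb * ty - tb * sy = q * \<gamma>" unfolding D[symmetric] sy_def ty_def by (simp add: algebra_simps)
  have "tb * sy \<ge> 0" using nn by (simp add: sy_def)
  then have "sb * ty + tb * sy \<ge> q * \<gamma>" using D' by linarith
  then have "(i * j) * (q * \<gamma>) \<le> (i * j) * (sb * ty + tb * sy)"
    using i j by (intro mult_left_mono) auto
  also have "\<dots> \<le> (i * sb + j * tb) * (i * sy + j * ty)"
  proof -
    have "0 \<le> i * i * (sb * sy) + j * j * (tb * ty)" using nn by (simp add: sy_def ty_def)
    then show ?thesis by (simp add: algebra_simps)
  qed
  also have "\<dots> = \<gamma> * \<gamma> * (zb * (za * q - zb * p))"
    unfolding zb[symmetric] zy[symmetric] by (simp add: algebra_simps)
  finally have "\<gamma> * ((i * j) * q) \<le> \<gamma> * (\<gamma> * (zb * (za * q - zb * p)))" by (simp add: algebra_simps)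
  then have "(i * j) * q \<le> \<gamma> * (zb * (za * q - zb * p))" using g by simp
  moreover have "\<gamma> * q < 3 * (i * j) * q" using ij q by simp
  ultimately have "\<gamma> * q < \<gamma> * (3 * zb * (za * q - zb * p))" by (simp add: algebra_simps)
  then show ?thesis using g by simp
qed

text \<open>
  Cramer's rule: the coordinates of \<open>z\<close> with respect to \<open>s\<close> and \<open>t\<close> are determinants.
\<close>
lemma solve_cone:
  fixes sa :: int
  assumes D: "ta * sb - sa * tb = \<gamma>"
  shows "\<gamma> * za = (ta * zb - za * tb) * sa + (za * sb - sa * zb) * ta"
    and "\<gamma> * zb = (ta * zb - za * tb) * sb + (za * sb - sa * zb) * tb"
  unfolding D[symmetric] by (simp_all add: algebra_simps)

text \<open>
  Follow the triangles towards \<open>z\<close> until \<open>z\<close> is a multiple of the vertex \<open>w\<close>. Then the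
  coordinates of \<open>z\<close> are multiples of \<open>\<alpha>\<close> and \<open>\<beta>\<close> and \<open>wedge_bound\<close> applies, because
  \<open>3 \<alpha> \<beta> > \<gamma>\<close>. The walk ends because the vertices met on the way lie in a bounded box: if
  \<open>\<gamma> z = i s + j t\<close> with positive integers \<open>i, j\<close>, then \<open>X(s)\<close> and \<open>X(t)\<close> are at most \<open>\<gamma> X(z)\<close>, and
  the same holds for \<open>Y\<close>; and each step removes \<open>w\<close> from the open cone between \<open>s\<close> and \<open>t\<close>.
\<close>
lemma cone_descent_bound:
  fixes p q :: int
  assumes q: "q > 0" and K: "finite K"
    and box: "\<And>va vb. 0 \<le> vb \<Longrightarrow> vb \<le> M * zb \<Longrightarrow> 0 \<le> va * q - vb * p \<Longrightarrow>
                va * q - vb * p \<le> M * (za * q - zb * p) \<Longrightarrow> (va, vb) \<in> K"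
  shows "\<lbrakk>triangle_pair \<gamma> \<alpha> \<beta> sa sb ta tb oa ob wa wb; \<gamma> \<le> M; \<alpha> \<le> M; \<beta> \<le> M;
          sb \<ge> 0; tb \<ge> 0; sa * q - sb * p \<ge> 0; ta * q - tb * p \<ge> 0;
          za * sb - sa * zb > 0; ta * zb - za * tb > 0\<rbrakk>
        \<Longrightarrow> q < 3 * zb * (za * q - zb * p)"
proof (induction "card {v \<in> K. fst v * sb - sa * snd v > 0 \<and> ta * snd v - fst v * tb > 0}"
       arbitrary: \<gamma> \<alpha> \<beta> sa sb ta tb oa ob wa wb rule: less_induct)
  case less
  note st = less.prems(1)
  note dets = triangle_pair_dets[OF st]
  have D: "ta * sb - sa * tb = \<gamma>" and w: "\<gamma> * wa = \<alpha> * sa + \<beta> * ta" "\<gamma> * wb = \<alpha> * sb + \<beta> * tb"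
    and m: "markov_triple \<gamma> \<alpha> \<beta>" and pos: "\<gamma> > 0" "\<alpha> > 0" "\<beta> > 0"
    using st by (auto simp: triangle_pair_def markov_triple_def)
  have wy: "\<gamma> * (wa * q - wb * p) = \<alpha> * (sa * q - sb * p) + \<beta> * (ta * q - tb * p)"
  proof -
    have "\<gamma> * (wa * q - wb * p) = (\<gamma> * wa) * q - (\<gamma> * wb) * p" by (simp add: algebra_simps)
    then show ?thesis unfolding w by (simp add: algebra_simps)
  qed
  have wb0: "wb \<ge> 0"
    using w(2) pos less.prems by (metis add_nonneg_nonneg less_imp_le mult_nonneg_nonneg zero_le_mult_iff linorder_not_less)
  have wy0: "wa * q - wb * p \<ge> 0"
    using wy pos less.prems by (metis add_nonneg_nonneg less_imp_le mult_nonneg_nonneg zero_le_mult_iff linorder_not_less)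
  define i where "i = ta * zb - za * tb"
  define j where "j = za * sb - sa * zb"
  have ij: "i > 0" "j > 0" using less.prems by (auto simp: i_def j_def)
  have z: "\<gamma> * za = i * sa + j * ta" "\<gamma> * zb = i * sb + j * tb"
    unfolding i_def j_def by (rule solve_cone[OF D])+
  let ?k = "za * wb - wa * zb"
  have k: "\<gamma> * ?k = \<alpha> * j - \<beta> * i"
  proof -
    have "\<gamma> * ?k = za * (\<gamma> * wb) - (\<gamma> * wa) * zb" by (simp add: algebra_simps)
    then show ?thesis unfolding w i_def j_def by (simp add: algebra_simps)
  qed
  have split_w: "\<gamma> * (va * wb - wa * vb) = \<alpha> * (va * sb - sa * vb) - \<beta> * (ta * vb - va * tb)" for va vb
  proof -
    have "\<gamma> * (va * wb - wa * vb) = va * (\<gamma> * wb) - (\<gamma> * wa) * vb" by (simp add: algebra_simps)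
    then show ?thesis unfolding w by (simp add: algebra_simps)
  qed
  let ?S = "{v \<in> K. fst v * sb - sa * snd v > 0 \<and> ta * snd v - fst v * tb > 0}"
  have fin: "finite ?S" using K by simp
  have bound: "e \<le> M * f" 
    if "\<delta> * f = i' * d + j' * e" "i' > 0" "j' > 0" "d \<ge> 0" "e \<ge> 0" "0 < \<delta>" "\<delta> \<le> M" "f \<ge> 0" 
      for \<delta> f d e i' j' :: int
  proof -
    have "1 * e \<le> j' * e" using that by (intro mult_right_mono) auto
    moreover have "0 \<le> i' * d" using that by simp
    ultimately have "e \<le> \<delta> * f" using that(1) by linarith
    also have "\<dots> \<le> M * f" using that by (intro mult_right_mono) auto
    finally show ?thesis .
  qed
  have zy: "\<gamma> * (za * q - zb * p) = i * (sa * q - sb * p) + j * (ta * q - tb * p)"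
  proof -
    have "\<gamma> * (za * q - zb * p) = (\<gamma> * za) * q - (\<gamma> * zb) * p" by (simp add: algebra_simps)
    then show ?thesis unfolding z by (simp add: algebra_simps)
  qed
  have zb0: "zb \<ge> 0"
    using z(2) pos ij less.prems by (metis add_nonneg_nonneg less_imp_le mult_nonneg_nonneg zero_le_mult_iff linorder_not_less)
  have zy0: "za * q - zb * p \<ge> 0"
    using zy pos ij less.prems by (metis add_nonneg_nonneg less_imp_le mult_nonneg_nonneg zero_le_mult_iff linorder_not_less)
  \<comment> \<open>The sign of \<open>?k\<close> tells on which side of \<open>w\<close> the vector \<open>z\<close> lies.\<close>
  consider "?k = 0" | "?k < 0" | "?k > 0" by linarith
  then show ?case
  proof cases
    case 1
    then have e: "\<alpha> * j = \<beta> * i" using k by simp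
    have "coprime \<alpha> \<beta>" using markov_triple_coprime[OF m] by simp
    then have "\<alpha> dvd i" "\<beta> dvd j"
      using e by (metis coprime_dvd_mult_right_iff dvd_triv_left, 
        metis coprime_commute coprime_dvd_mult_right_iff dvd_triv_left)
    then have "\<alpha> \<le> i" "\<beta> \<le> j" using ij by (auto intro: zdvd_imp_le)
    then have "\<alpha> * \<beta> \<le> i * j" using pos by (intro mult_mono) auto
    moreover have "\<gamma> < 3 * \<alpha> * \<beta>"
      by (rule markov_triple_vieta_pos[OF markov_triple_rotate[OF m]])
    ultimately have "\<gamma> < 3 * (i * j)" by simp
    then show ?thesis
      by (rule wedge_bound[OF q _ ij pos(1) D less.prems(5-8) z])
  next
    case 2
    let ?S' = "{v \<in> K. fst v * sb - sa * snd v > 0 \<and> wa * snd v - fst v * wb > 0}"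
    have sub: "?S' \<subseteq> ?S"
    proof clarsimp
      fix va vb assume "sa * vb < va * sb" "va * wb < wa * vb"
      then have "0 < \<alpha> * (va * sb - sa * vb)" "\<gamma> * (va * wb - wa * vb) < 0"
        using pos by (auto simp: mult_less_0_iff)
      then have "0 < \<beta> * (ta * vb - va * tb)" using split_w[of va vb] by linarith
      then show "va * tb < ta * vb" using pos by (simp add: zero_less_mult_iff)
    qed
    have D': "wa * sb - sa * wb = \<beta>" by (rule dets)
    have kk: "wa * zb - za * wb > 0" using 2 by simp
    have z': "\<beta> * zb = (wa * zb - za * wb) * sb + j * wb"
      "\<beta> * (za * q - zb * p) = (wa * zb - za * wb) * (sa * q - sb * p) + j * (wa * q - wb * p)"
      unfolding j_def D'[symmetric] by (simp_all add: algebra_simps)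
    have "wb \<le> M * zb" "wa * q - wb * p \<le> M * (za * q - zb * p)"
      using bound[OF z'(1) kk] bound[OF z'(2) kk] ij pos wb0 wy0 zb0 zy0 less.prems by auto
    then have "(wa, wb) \<in> ?S" using box[of wb wa] wb0 wy0 dets pos by auto
    moreover have "(wa, wb) \<notin> ?S'" by simp
    ultimately have "?S' \<subset> ?S" using sub by blast
    then have c: "card ?S' < card ?S" by (rule psubset_card_mono[OF fin])
    show ?thesis
      by (rule less.hyps[OF c triangle_pair_left[OF st]])
        (use less.prems kk wb0 wy0 in auto)
  next
    case 3
    let ?S' = "{v \<in> K. fst v * wb - wa * snd v > 0 \<and> ta * snd v - fst v * tb > 0}"
    have sub: "?S' \<subseteq> ?S"
    proof clarsimp
      fix va vb assume "wa * vb < va * wb" "va * tb < ta * vb"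
      then have "0 < \<beta> * (ta * vb - va * tb)" "\<gamma> * (va * wb - wa * vb) > 0"
        using pos by auto
      then have "0 < \<alpha> * (va * sb - sa * vb)" using split_w[of va vb] by linarith
      then show "sa * vb < va * sb" using pos by (simp add: zero_less_mult_iff)
    qed
    have D': "ta * wb - wa * tb = \<alpha>" by (rule dets)
    have kk: "za * wb - wa * zb > 0" using 3 by simp
    have z': "\<alpha> * zb = (za * wb - wa * zb) * tb + i * wb"
      "\<alpha> * (za * q - zb * p) = (za * wb - wa * zb) * (ta * q - tb * p) + i * (wa * q - wb * p)"
      unfolding i_def D'[symmetric] by (simp_all add: algebra_simps)
    have "wb \<le> M * zb" "wa * q - wb * p \<le> M * (za * q - zb * p)"
      using bound[OF z'(1) kk] bound[OF z'(2) kk] ij pos wb0 wy0 zb0 zy0 less.prems by auto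
    then have "(wa, wb) \<in> ?S" using box[of wb wa] wb0 wy0 dets pos by auto
    moreover have "(wa, wb) \<notin> ?S'" by simp
    ultimately have "?S' \<subset> ?S" using sub by blast
    then have c: "card ?S' < card ?S" by (rule psubset_card_mono[OF fin])
    show ?thesis
      by (rule less.hyps[OF c triangle_pair_right[OF st]])
        (use less.prems kk wb0 wy0 in auto)
  qed
qed

text \<open>
  The walk starts at the edge from \<open>(p, q)\<close> to \<open>(1, 0)\<close>, whose two adjacent triangles have the
  neighbours of \<open>p / q\<close> in its triple as their third vertices.
\<close>
lemma frac_triple_bound_right:
  assumes ft: "frac_triple p1 q1 p q p3 q3" and b: "b > 0" and gt: "a * q - b * p > 0"
  shows "q < 3 * b * (a * q - b * p)"
proof -
  have m: "markov_triple q1 q q3" and e: "p * q1 - p1 * q = q3" "p3 * q - p * q3 = q1"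
    using ft by (auto simp: frac_triple_def)
  have pos: "q1 > 0" "q > 0" "q3 > 0" using m by (auto simp: markov_triple_def)
  define M where "M = q1 + q + q3"
  define h where "h = (\<lambda>v::int\<times>int. (snd v, fst v * q - snd v * p))"
  define K where "K = h -` ({0..M * b} \<times> {0..M * (a * q - b * p)})"
  have "inj h" using pos by (auto simp: inj_def h_def)
  then have fK: "finite K" unfolding K_def by (intro finite_vimageI) auto
  have tp: "triangle_pair q q3 q1 p q 1 0 p1 q1 p3 q3"
    unfolding triangle_pair_def using m e by (auto simp: markov_triple_def algebra_simps)
  show ?thesis
    by (rule cone_descent_bound[OF pos(2) fK _ tp, where M = M])
      (use pos b gt in \<open>auto simp: K_def h_def M_def algebra_simps\<close>)
qed

text \<open>
  Negation reverses a triple and takes the fractions to the left of \<open>p / q\<close> to the right of \<open>- p / q\<close>.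
\<close>
lemma frac_triple_bound:
  assumes ft: "frac_triple p1 q1 p q p3 q3" and b: "b > 0" and ne: "a * q - b * p \<noteq> 0"
  shows "q < 3 * b * \<bar>a * q - b * p\<bar>"
proof (cases "a * q - b * p > 0")
  case True
  then show ?thesis using frac_triple_bound_right[OF ft b] by simp
next
  case False
  then have "q < 3 * b * ((- a) * q - b * (- p))"
    using ne by (intro frac_triple_bound_right[OF frac_triple_minus[OF ft] b]) simp
  then show ?thesis using False by (simp add: algebra_simps)
qed

section \<open>Companions are badly approximable\<close>

text \<open>
  The recursion of the companion sequence with arbitrary initial values. It governs the companion
  sequence, the determinants of a fraction with the companions, and the numerators and denominators
  of the fractions that fan out from a fixed Markov fraction in the Markov tree.
\<close>
fun orbit :: "int \<Rightarrow> int \<Rightarrow> int \<Rightarrow> nat \<Rightarrow> int" where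
  "orbit q x y 0 = x"
| "orbit q x y (Suc 0) = y"
| "orbit q x y (Suc (Suc n)) = 3 * q * orbit q x y (Suc n) - orbit q x y n"

lemma orbit_shift:
  "orbit q x y (Suc (j + i)) =
     orbit q x y (Suc j) * companion_seq q (Suc i) - orbit q x y j * companion_seq q i"
proof (induction i rule: induct_nat_012)
  case (ge2 n)
  have "orbit q x y (Suc (j + Suc (Suc n))) = 3 * q * orbit q x y (Suc (j + Suc n)) - orbit q x y (Suc (j + n))"
    by simp
  then show ?case unfolding ge2 by (simp add: algebra_simps)
qed simp_all

lemma orbit_companion_seq: "orbit q 0 1 n = companion_seq q n"
  by (induction q n rule: companion_seq.induct) simp_all

text \<open>
  The right-hand side is the Casoratian of two solutions of one recursion whose characteristic polynomial
  has constant term \<open>1\<close>, hence it is independent of \<open>j\<close>.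
\<close>
lemma orbit_start:
  "x = orbit q x y j * companion_seq q (Suc j) - orbit q x y (Suc j) * companion_seq q j"
  by (induction j) (simp_all add: algebra_simps)

lemma companion_seq_growth:
  assumes "q > 0"
  shows "0 \<le> companion_seq q n \<and> 0 < companion_seq q (Suc n) \<and>
         companion_seq q n \<le> companion_seq q (Suc n) \<and> 2 * q * companion_seq q n \<le> companion_seq q (Suc n)"
proof (induction n)
  case (Suc n)
  let ?u = "companion_seq q"
  have "1 * ?u (Suc n) \<le> q * ?u (Suc n)" using assms Suc by (intro mult_right_mono) auto
  moreover have "?u (Suc (Suc n)) = 3 * (q * ?u (Suc n)) - ?u n" by simp
  ultimately show ?case using Suc by (intro conjI) linarith+
qed simp

lemma companion_seq_mono:
  assumes "q > 0" "i \<le> j" shows "companion_seq q i \<le> companion_seq q j"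
  using companion_seq_growth[OF assms(1)] by (intro lift_Suc_mono_le[OF _ assms(2)]) auto

lemma companion_seq_step:
  assumes "q > 0" "i \<ge> 1" shows "companion_seq q (Suc i) \<le> 3 * q * companion_seq q i"
  using assms(2) companion_seq_growth[OF assms(1)] by (cases i) auto

text \<open>
  Look at the minimum: if the next value is not larger, it is equal, and the recursion
  makes the one after it larger.
\<close>
lemma orbit_eventually_increasing:
  assumes q: "q > 0" and pos: "\<And>n. orbit q x y n > 0"
  shows "\<exists>n. orbit q x y n < orbit q x y (Suc n)"
proof -
  let ?W = "orbit q x y"
  obtain N where N: "\<And>m. nat (?W N) \<le> nat (?W m)"
    using ex_has_least_nat[of "\<lambda>_. True" 0 "\<lambda>n. nat (?W n)"] by auto
  then have N': "?W N \<le> ?W m" for m using pos by (metis nat_le_eq_zle)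
  show ?thesis
  proof (cases "?W N < ?W (Suc N)")
    case False
    then have e: "?W (Suc N) = ?W N" using N' by (metis antisym_conv1)
    have "1 * ?W N \<le> q * ?W N" using q pos[of N] by (intro mult_right_mono) auto
    then have "?W (Suc N) < ?W (Suc (Suc N))" using e pos[of N] by simp
    then show ?thesis by blast
  qed blast
qed

text \<open>
  With \<open>c = q\<^sup>2\<close> the hypothesis is the Markov equation for \<open>(q, S, T)\<close>, and the conclusion says that
  the companions of a fraction with denominator \<open>q\<close> stay below its neighbour of denominator \<open>T\<close> at
  distance \<open>S / (q T)\<close>. The induction replaces \<open>(S, T)\<close> by the neighbouring solution \<open>(3 q S - T, S)\<close>,
  which is again positive, and lowers \<open>k\<close>.
\<close>
lemma companion_below_orbit:
  assumes "S > 0" "T > 0" "c > 0" "S * S + T * T + c = 3 * q * S * T"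
  shows "S * companion_seq q (Suc k) - T * companion_seq q k > 0"
  using assms
proof (induction k arbitrary: S T)
  case (Suc k)
  have "T * (3 * q * S - T) = S * S + c" using Suc.prems by (simp add: algebra_simps)
  then have "T * (3 * q * S - T) > 0" using Suc.prems by (simp add: add_pos_pos)
  then have p: "3 * q * S - T > 0" using Suc.prems by (simp add: zero_less_mult_iff)
  have "(3 * q * S - T) * companion_seq q (Suc k) - S * companion_seq q k > 0"
    by (rule Suc.IH) (use Suc.prems p in \<open>auto simp: algebra_simps\<close>)
  then show ?case by (simp add: algebra_simps)
qed simp

text \<open>
  Repeatedly taking the left child keeps the left fraction \<open>p / q\<close>; the other fractions approach
  the limit of its right companions from above.
\<close>
lemma frac_triple_right_fan:
  assumes "frac_triple p1 q1 p q p3 q3"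
  shows "frac_triple p q (orbit q (p1 + 3 * q1) p3 (Suc n)) (orbit q q1 q3 (Suc n))
           (orbit q (p1 + 3 * q1) p3 n) (orbit q q1 q3 n)"
proof (induction n)
  case 0
  then show ?case using frac_triple_rotate[OF assms] by simp
next
  case (Suc n)
  then show ?case using frac_triple_left_child[OF Suc] by simp
qed

lemma orbit_sign_change:
  assumes "orbit q x y 1 > 0" and "\<not> (\<forall>n. n \<ge> 1 \<longrightarrow> orbit q x y n > 0)"
  obtains j where "j \<ge> 1" "orbit q x y j > 0" "orbit q x y (Suc j) \<le> 0"
proof -
  define N where "N = (LEAST n. n \<ge> 1 \<and> orbit q x y n \<le> 0)"
  have "\<exists>n. n \<ge> 1 \<and> orbit q x y n \<le> 0" using assms(2) by (auto simp: not_less)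
  then have N: "N \<ge> 1" "orbit q x y N \<le> 0" unfolding N_def by (metis (mono_tags, lifting) LeastI)+
  have least: "orbit q x y m > 0" if "m \<ge> 1" "m < N" for m
    using not_less_Least[of m "\<lambda>n. n \<ge> 1 \<and> orbit q x y n \<le> 0"] that unfolding N_def by auto
  have "N \<noteq> 1" using N assms(1) by auto
  then obtain j where "N = Suc j" "j \<ge> 1" using N by (cases N) auto
  then show ?thesis using that[of j] N least[of j] by auto
qed

text \<open>
  Modulo \<open>q\<close> the recursion changes the sign every two steps, and so does multiplication by \<open>- p\<close>, as
  \<open>p\<^sup>2 \<equiv> -1\<close>.
\<close>
lemma orbit_cong:
  assumes d: "q dvd p\<^sup>2 + 1" and "q dvd y + p * x"
  shows "q dvd orbit q x y (Suc n) + p * orbit q x y n"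
proof (induction n)
  case 0 then show ?case using assms by simp
next
  case (Suc n)
  let ?W = "orbit q x y"
  have "?W (Suc (Suc n)) + p * ?W (Suc n)
      = q * (3 * ?W (Suc n)) + p * (?W (Suc n) + p * ?W n) - (p\<^sup>2 + 1) * ?W n"
    by (simp add: algebra_simps power2_eq_square)
  also have "q dvd \<dots>" using Suc d by (intro dvd_diff dvd_add) auto
  finally show ?case .
qed

text \<open>
  Here \<open>orbit q b A (Suc k)\<close> is the determinant of \<open>a / b\<close> with the companion, which
  has denominator \<open>q * companion_seq q (Suc k)\<close>. The cases follow the position of \<open>a / b\<close> among \<open>p / q\<close>
  and its companions; the bound can be attained only at \<open>a / b = p / q\<close>.
\<close>
lemma companion_bound_right:
  assumes ft: "frac_triple p1 q1 p q p3 q3" and b: "b > 0" and k: "k \<ge> 1"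
    and A: "A = a * q - b * p"
    and ne: "orbit q b A (Suc k) \<noteq> 0"
  shows "q * companion_seq q (Suc k) \<le> 3 * b * \<bar>orbit q b A (Suc k)\<bar> \<and>
         (k \<ge> 2 \<longrightarrow> q * companion_seq q (Suc k) < 3 * b * \<bar>orbit q b A (Suc k)\<bar>)"
proof -
  let ?u = "companion_seq q" and ?W = "orbit q b A"
  have q: "q > 0" using ft by (auto simp: frac_triple_def markov_triple_def)
  note g = companion_seq_growth[OF q]
  have Wk: "?W (Suc k) = A * ?u (Suc k) - b * ?u k" using orbit_shift[of q b A 0 k] by simp
  obtain k' where k': "k = Suc k'" using k by (cases k) auto
  have uk: "?u k > 0" using g[of k'] k' by simp
  have uk1: "?u (Suc k) > 0" using g[of k] by simp
  have dvdA: "q dvd A + p * b" unfolding A by simp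
  consider "A < 0" | "A = 0" | "A > 0" "\<forall>n. n \<ge> 1 \<longrightarrow> ?W n > 0"
    | j where "A > 0" "j \<ge> 1" "?W j > 0" "?W (Suc j) \<le> 0"
  proof (cases "A > 0 \<and> \<not> (\<forall>n. n \<ge> 1 \<longrightarrow> ?W n > 0)")
    case True
    then show ?thesis using orbit_sign_change[of q b A] that(4) by auto
  qed (use that in force)
  then show ?thesis
  proof cases
    \<comment> \<open>To the left of \<open>p / q\<close>, which is closer than the companion.\<close>
    case 1
    have "q < 3 * b * \<bar>A\<bar>" using frac_triple_bound[OF ft b, of a] 1 A by simp
    then have "q * ?u (Suc k) < (3 * b * \<bar>A\<bar>) * ?u (Suc k)" using uk1 by (intro mult_strict_right_mono)
    also have "\<dots> = 3 * b * (\<bar>A\<bar> * ?u (Suc k))" by simp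
    also have "\<dots> \<le> 3 * b * \<bar>?W (Suc k)\<bar>"
    proof -
      have "A * ?u (Suc k) < 0" using 1 uk1 by (simp add: mult_neg_pos)
      moreover have "b * ?u k \<ge> 0" using b uk by simp
      ultimately have "\<bar>?W (Suc k)\<bar> = \<bar>A\<bar> * ?u (Suc k) + b * ?u k" using Wk 1 by simp
      then show ?thesis using b uk by simp
    qed
    finally show ?thesis by simp
  next
    \<comment> \<open>The fraction is \<open>p / q\<close> itself.\<close>
    case 2
    then have "q dvd b * p" using A by (metis dvd_triv_right eq_iff_diff_eq_0)
    then have "q dvd b" using frac_triple_coprime[OF ft] coprime_dvd_mult_left_iff coprime_commute by blast
    then have "q \<le> b" using b by (simp add: zdvd_imp_le)
    then have qb: "q * q \<le> b * b" using q b by (intro mult_mono) auto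
    have W: "\<bar>?W (Suc k)\<bar> = b * ?u k" using Wk 2 b uk by simp
    have "q * ?u (Suc k) = q * (3 * q * ?u k) - q * ?u k'" using k' by (simp add: algebra_simps)
    also have "q * (3 * q * ?u k) = 3 * (q * q) * ?u k" by simp
    finally have e: "q * ?u (Suc k) = 3 * (q * q) * ?u k - q * ?u k'" .
    have "3 * (q * q) * ?u k \<le> 3 * (b * b) * ?u k" using qb uk by (intro mult_right_mono) auto
    moreover have "k \<ge> 2 \<Longrightarrow> q * ?u k' > 0" using k' q g[of "k' - 1"] by (cases k') auto
    moreover have "q * ?u k' \<ge> 0" using g q by simp
    moreover have "3 * b * \<bar>?W (Suc k)\<bar> = 3 * (b * b) * ?u k" unfolding W by simp
    ultimately show ?thesis unfolding e by linarith
  next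
    \<comment> \<open>Beyond the limit of the companions: some fraction \<open>V / T\<close> of the fan lies between.\<close>
    case 3
    let ?Q = "orbit q q1 q3" and ?P = "orbit q (p1 + 3 * q1) p3"
    note fan = frac_triple_right_fan[OF ft]
    have Qpos: "?Q n > 0" for n using fan[of n] by (auto simp: frac_triple_def markov_triple_def)
    have Wpos: "?W n > 0" for n using 3(2) b by (cases n) auto
    obtain N where N: "?Q N < ?Q (Suc N)" using orbit_eventually_increasing[OF q Qpos] by blast
    obtain i where i: "?W i < ?W (Suc i)" using orbit_eventually_increasing[OF q Wpos] by blast
    define n where "n = N + i"
    define S T V where "S = ?Q n" and "T = ?Q (Suc n)" and "V = ?P (Suc n)"
    \<comment> \<open>Both sequences grow at \<open>N\<close> and \<open>i\<close>, so \<open>V / T\<close> with index \<open>N + i + 1\<close> lies to the left of \<open>a / b\<close>.\<close>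
    have E: "A * T - b * S = ?Q (Suc N) * ?W (Suc i) - ?Q N * ?W i"
    proof (cases i)
      case 0
      then show ?thesis by (simp add: S_def T_def n_def)
    next
      case (Suc i')
      have "S = ?Q (Suc N) * ?u (Suc i') - ?Q N * ?u i'"
        using orbit_shift[of q q1 q3 N i'] by (simp add: S_def n_def Suc)
      moreover have "T = ?Q (Suc N) * ?u (Suc i) - ?Q N * ?u i"
        using orbit_shift[of q q1 q3 N i] by (simp add: T_def n_def)
      moreover have "?W (Suc i) = A * ?u (Suc i) - b * ?u i" using orbit_shift[of q b A 0 i] by simp
      moreover have "?W i = A * ?u i - b * ?u i'" using orbit_shift[of q b A 0 i'] Suc by simp
      ultimately show ?thesis unfolding Suc by (simp only:) (simp only: algebra_simps)
    qed
    have "?Q N * ?W i < ?Q (Suc N) * ?W (Suc i)"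
      using N i Qpos[of N] Wpos[of i] by (intro mult_strict_mono) auto
    then have Epos: "A * T - b * S > 0" using E by simp
    have fV: "frac_triple p q V T (orbit q (p1 + 3 * q1) p3 n) S" unfolding S_def T_def V_def by (rule fan)
    have VT: "V * q - p * T = S" using fV by (simp add: frac_triple_def)
    have T: "T > 0" "S > 0" using Qpos by (auto simp: S_def T_def)
    define e where "e = a * T - b * V"
    have qe: "q * e = A * T - b * S" unfolding e_def A VT[symmetric] by (simp add: algebra_simps)
    then have "e > 0" using Epos q by (metis zero_less_mult_pos)
    then have eb: "T < 3 * b * e" using frac_triple_bound[OF fV b, of a] by (simp add: e_def)
    \<comment> \<open>The companion lies to the left of \<open>V / T\<close>.\<close>
    have R: "S * ?u (Suc k) - T * ?u k > 0"
      by (rule companion_below_orbit[where c = "q * q"])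
        (use T q fV in \<open>auto simp: frac_triple_def markov_triple_def power2_eq_square algebra_simps\<close>)
    have "T * ?W (Suc k) = (A * T - b * S) * ?u (Suc k) + b * (S * ?u (Suc k) - T * ?u k)"
      unfolding Wk by (simp add: algebra_simps)
    also have "\<dots> \<ge> (A * T - b * S) * ?u (Suc k)" using R b by simp
    finally have "q * e * ?u (Suc k) \<le> T * ?W (Suc k)" unfolding qe .
    then have "3 * b * (q * e * ?u (Suc k)) \<le> 3 * b * (T * ?W (Suc k))" using b by (intro mult_left_mono) auto
    moreover have "T * (q * ?u (Suc k)) < 3 * b * e * (q * ?u (Suc k))"
      using eb q uk1 by (intro mult_strict_right_mono) auto
    ultimately have "T * (q * ?u (Suc k)) < T * (3 * b * ?W (Suc k))" by (simp add: mult_ac)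
    then have "q * ?u (Suc k) < 3 * b * ?W (Suc k)" using T by simp
    also have "\<dots> = 3 * b * \<bar>?W (Suc k)\<bar>" using Wpos[of "Suc k"] by simp
    finally show ?thesis by simp
  next
    \<comment> \<open>Between the companions with index \<open>j\<close> and \<open>Suc j\<close>, or equal to the latter;
      for \<open>j = 1\<close> the former is \<open>p / q\<close>.\<close>
    case 4
    define m n where "m = ?W j" and "n = - ?W (Suc j)"
    have mn: "m > 0" "n \<ge> 0" using 4 by (auto simp: m_def n_def)
    have bmn: "b = m * ?u (Suc j) + n * ?u j"
      using orbit_start[of b q A j] by (simp add: m_def n_def)
    have uj: "?u j > 0" using g[of "j - 1"] 4 by (cases j) auto
    have uj1: "?u (Suc j) > 0" using g by simp
    have bm: "m * ?u (Suc j) \<le> b" using bmn mn uj by simp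
    have cong: "q dvd p * m - n"
      using orbit_cong[OF frac_triple_dvd_sq[OF ft] dvdA, of j] by (simp add: m_def n_def algebra_simps)
    have strict: "q * ?u (Suc k) < 3 * b * \<bar>?W (Suc k)\<bar>"
    proof (cases "Suc k \<le> j")
      case True
      have "2 * q * ?u j \<le> ?u (Suc j)" using g by simp
      moreover have "q * ?u (Suc k) \<le> q * ?u j" using companion_seq_mono[OF q True] q by simp
      moreover have "1 * ?u (Suc j) \<le> m * ?u (Suc j)" using mn uj1 by (intro mult_right_mono) auto
      moreover have "0 < q * ?u j" using q uj by simp
      ultimately have "q * ?u (Suc k) < 3 * b * 1" using bm b by linarith
      also have "\<dots> \<le> 3 * b * \<bar>?W (Suc k)\<bar>" using ne b by (intro mult_left_mono) auto
      finally show ?thesis .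
    next
      case False
      define i where "i = k - j"
      have ki: "k = j + i" using False by (simp add: i_def)
      have "?W (Suc k) = - (n * ?u (Suc i) + m * ?u i)"
        unfolding ki orbit_shift by (simp add: m_def n_def)
      moreover have ui: "?u i \<ge> 0" "?u (Suc i) > 0" using g by auto
      moreover have "n * ?u (Suc i) + m * ?u i \<ge> 0" using mn ui by simp
      ultimately have absW: "\<bar>?W (Suc k)\<bar> = n * ?u (Suc i) + m * ?u i" by linarith
      have uk_eq: "?u (Suc k) = ?u (Suc j) * ?u (Suc i) - ?u j * ?u i"
        using orbit_shift[of q 0 1 j i] by (simp add: ki orbit_companion_seq)
      have "?u j * ?u i \<ge> 0" using uj ui by simp
      then have uk_le: "q * ?u (Suc k) \<le> q * (?u (Suc j) * ?u (Suc i))" using uk_eq q by simp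
      show ?thesis
      proof (cases "n = 0")
        case False
        \<comment> \<open>The congruence makes \<open>n\<close> the determinant of \<open>p / q\<close> with a fraction of denominator \<open>m\<close>.\<close>
        obtain c where c: "p * m - n = q * c" using cong by blast
        have "q < 3 * m * \<bar>c * q - m * p\<bar>"
          by (rule frac_triple_bound[OF ft mn(1)]) (use c False in \<open>auto simp: algebra_simps\<close>)
        moreover have "\<bar>c * q - m * p\<bar> = n" using c mn by (simp add: algebra_simps)
        ultimately have "q < 3 * (m * n)" by simp
        then have "q * (?u (Suc j) * ?u (Suc i)) < 3 * (m * n) * (?u (Suc j) * ?u (Suc i))"
          using uj1 ui by (intro mult_strict_right_mono) auto
        also have "\<dots> = 3 * (m * ?u (Suc j)) * (n * ?u (Suc i))" by simp
        also have "\<dots> \<le> 3 * b * (n * ?u (Suc i) + m * ?u i)"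
          using bm b mn ui uj1 by (intro mult_mono) auto
        finally show ?thesis using uk_le absW by simp
      next
        case True
        have i: "i \<ge> 1" using ne absW True by (cases i) auto
        have "q dvd m" using cong True frac_triple_coprime[OF ft]
          by (simp add: coprime_commute coprime_dvd_mult_right_iff)
        then have "q \<le> m" using mn by (simp add: zdvd_imp_le)
        then have qm: "q * q \<le> m * m" using q by (intro mult_mono) auto
        have uip: "?u i > 0" using g[of "i - 1"] i by (cases i) auto
        have "q * ?u (Suc k) = q * (?u (Suc j) * ?u (Suc i)) - q * (?u j * ?u i)"
          unfolding uk_eq by (simp add: algebra_simps)
        also have "\<dots> < q * (?u (Suc j) * ?u (Suc i))" using q uj uip by simp
        also have "\<dots> \<le> q * (?u (Suc j) * (3 * q * ?u i))"
          using companion_seq_step[OF q i] q uj1 by (intro mult_left_mono) auto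
        also have "\<dots> = 3 * (q * q) * (?u (Suc j) * ?u i)" by simp
        also have "\<dots> \<le> 3 * (m * m) * (?u (Suc j) * ?u i)"
          using qm uj1 uip by (intro mult_right_mono) auto
        also have "\<dots> = 3 * (m * ?u (Suc j)) * (m * ?u i)" by simp
        also have "\<dots> \<le> 3 * b * (m * ?u i)" using bm mn uip b by (intro mult_right_mono) auto
        finally show ?thesis using absW True by simp
      qed
    qed
    then show ?thesis by simp
  qed
qed

section \<open>Searching the Markov tree\<close>

lemma companion_seq_det:
  "companion_seq q (Suc j) * companion_seq q (Suc j) - companion_seq q j * companion_seq q (Suc (Suc j)) = 1"
  by (induction j) (simp_all add: algebra_simps)

text \<open>
  Each step of the recursion is a Vieta involution of the quadratic form \<open>x\<^sup>2 - 3 q x y + y\<^sup>2\<close>.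
\<close>
lemma orbit_invariant:
  "orbit q x y n * orbit q x y n + orbit q x y (Suc n) * orbit q x y (Suc n)
     - 3 * q * orbit q x y n * orbit q x y (Suc n) = x * x + y * y - 3 * q * x * y"
  by (induction n) (simp_all add: algebra_simps)

text \<open>
  Suppose \<open>a / b\<close> is strictly between the companions with index \<open>j\<close> and \<open>j + 1\<close>, at determinants
  \<open>m\<close> and \<open>n\<close>. As \<open>b = m u\<^sub>j\<^sub>+\<^sub>1 + n u\<^sub>j\<close>, the bounds at the two companions read
  \<open>n u\<^sub>j \<le> m u\<^sub>j\<^sub>-\<^sub>1\<close> and \<open>m u\<^sub>j\<^sub>+\<^sub>1 \<le> n u\<^sub>j\<^sub>+\<^sub>2\<close>, so that \<open>u\<^sub>j u\<^sub>j\<^sub>+\<^sub>1 \<le> u\<^sub>j\<^sub>-\<^sub>1 u\<^sub>j\<^sub>+\<^sub>2\<close>. But the difference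
  of these products is \<open>3 q\<close>.
\<close>
lemma gap_dichotomy:
  assumes q: "q > 0" and b: "b > 0" and A: "A = a * q - b * p" "A > 0"
    and good: "\<And>c d. d > 0 \<Longrightarrow> a * d \<noteq> b * c \<Longrightarrow> b \<le> 3 * d * \<bar>a * d - b * c\<bar>"
  shows "(\<exists>k\<ge>2. orbit q b A k = 0) \<or> (\<forall>n. orbit q b A n > 0)"
proof (cases "\<forall>n\<ge>1. orbit q b A n > 0")
  case True
  then have "orbit q b A n > 0" for n using b by (cases n) auto
  then show ?thesis by simp
next
  case False
  let ?W = "orbit q b A" and ?u = "companion_seq q"
  note g = companion_seq_growth[OF q]
  obtain j where j: "j \<ge> 1" "?W j > 0" "?W (Suc j) \<le> 0"
    using orbit_sign_change[of q b A] False A(2) by auto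
  have good': "b \<le> 3 * (q * ?u (Suc i)) * \<bar>?W (Suc i)\<bar>" if "?W (Suc i) \<noteq> 0" for i
  proof -
    have "?W (Suc i) = a * (q * ?u (Suc i)) - b * (p * ?u (Suc i) + ?u i)"
      using orbit_shift[of q b A 0 i] by (simp add: A(1) algebra_simps)
    then show ?thesis using good[of "q * ?u (Suc i)" "p * ?u (Suc i) + ?u i"] that g[of i] q by simp
  qed
  show ?thesis
  proof (cases "?W (Suc j) = 0")
    case True
    then show ?thesis using j by (intro disjI1 exI[of _ "Suc j"]) auto
  next
    case False
    obtain i where i: "j = Suc i" using j by (cases j) auto
    define m n where "m = ?W j" and "n = - ?W (Suc j)"
    have mn: "m > 0" "n > 0" using j False by (auto simp: m_def n_def)
    have bmn: "b = m * ?u (Suc j) + n * ?u j"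
      using orbit_start[of b q A j] by (simp add: m_def n_def)
    have "b \<le> 3 * (q * ?u j) * m" using good'[of i] j i by (simp add: m_def)
    then have 1: "n * ?u j \<le> m * ?u i" unfolding bmn i by (simp add: algebra_simps)
    have "b \<le> 3 * (q * ?u (Suc j)) * n" using good'[of j] j False by (simp add: n_def)
    then have 2: "m * ?u (Suc j) \<le> n * ?u (Suc (Suc j))" unfolding bmn by (simp add: algebra_simps)
    have "(n * ?u j) * ?u (Suc j) \<le> (m * ?u i) * ?u (Suc j)"
      using 1 g[of j] by (intro mult_right_mono) auto
    also have "\<dots> = (m * ?u (Suc j)) * ?u i" by simp
    also have "\<dots> \<le> (n * ?u (Suc (Suc j))) * ?u i"
      using 2 g[of i] by (intro mult_right_mono) auto
    finally have "n * (?u j * ?u (Suc j)) \<le> n * (?u (Suc (Suc j)) * ?u i)" by (simp add: mult_ac)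
    then have "?u j * ?u (Suc j) \<le> ?u (Suc (Suc j)) * ?u i" using mn by simp
    moreover have "?u j * ?u (Suc j) - ?u (Suc (Suc j)) * ?u i = 3 * q * (?u j * ?u j - ?u i * ?u (Suc j))"
      by (simp add: i algebra_simps)
    then have "?u j * ?u (Suc j) - ?u (Suc (Suc j)) * ?u i = 3 * q"
      using companion_seq_det[of q i] by (simp add: i)
    ultimately show ?thesis using q by simp
  qed
qed

text \<open>
  Here \<open>q\<close> and \<open>r\<close> are the denominators of the outer fractions of a triple, \<open>s\<close> is their
  determinant, and \<open>A\<close> and \<open>B\<close> are the determinants of these fractions with a fraction of denominator \<open>b\<close>
  between them. Let \<open>h(x, y) = x\<^sup>2 - 3 q x y + y\<^sup>2\<close>. If that fraction is beyond all companions of the left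
  fraction, then \<open>h(A, b)\<close> is a negative integer, while \<open>h(s, r) = - q\<^sup>2\<close> by the Markov equation.
  Since \<open>A / b < s / r\<close> and \<open>h(x, 1)\<close> decreases for small \<open>x\<close>, comparing the values gives
  \<open>r\<^sup>2 \<le> q\<^sup>2 b\<^sup>2\<close>, and \<open>q \<le> b\<close>.
\<close>
lemma outer_denominator_bound:
  assumes m: "markov_triple q r s" and le: "q \<le> r" "s \<le> r" and AB: "A > 0" "B > 0"
    and e: "A * r + B * q = b * s" and W: "\<And>n. orbit q b A n > 0"
  shows "r \<le> b * b"
proof -
  have pos: "q > 0" "r > 0" "s > 0" and me: "q * q + r * r + s * s = 3 * q * r * s"
    using m by (auto simp: markov_triple_def power2_eq_square)
  have b: "b > 0" using W[of 0] by simp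
  have "q * q \<le> r * r" "s * s \<le> r * r" using pos le by (auto intro: mult_mono)
  then have "r * (q * s) \<le> r * r" using me by (simp add: algebra_simps)
  then have qs: "q * s \<le> r" using pos by simp
  have Bq: "B * q > 0" using AB pos by simp
  have "1 * r \<le> A * r" using AB pos by (intro mult_right_mono) auto
  then have "r < b * s" using e Bq by linarith
  then have "q * r < q * (b * s)" using pos by simp
  also have "\<dots> \<le> b * r" using qs b by (simp add: mult.left_commute)
  finally have qb: "q < b" using pos by simp
  have bs: "b * s \<le> b * r" using le b by simp
  then have "A * r < b * r" using e Bq by linarith
  then have Ab: "A < b" using pos by simp
  let ?W = "orbit q b A"
  let ?P = "\<lambda>n. ?W n < ?W (Suc n)"
  have ex: "\<exists>n. ?P n" by (rule orbit_eventually_increasing[OF pos(1) W])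
  \<comment> \<open>At the first \<open>n\<close> with \<open>W\<^sub>n < W\<^sub>n\<^sub>+\<^sub>1\<close>, \<open>h(A, b) = W\<^sub>n\<^sup>2 - W\<^sub>n\<^sub>-\<^sub>1 W\<^sub>n\<^sub>+\<^sub>1\<close> is visibly negative.\<close>
  define n where "n = (LEAST n. ?P n)"
  have n: "?P n" unfolding n_def by (rule LeastI_ex[OF ex])
  then have "n \<noteq> 0" using Ab by (cases n) auto
  then obtain i where i: "n = Suc i" by (cases n) auto
  have "\<not> ?P i" using not_less_Least[of i ?P] i unfolding n_def by simp
  then have "?W n * ?W n < ?W (Suc n) * ?W i" using n W[of n] i
    by (intro mult_less_le_imp_less) auto
  moreover have "?W n * ?W n - ?W (Suc n) * ?W i = b * b + A * A - 3 * q * b * A"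
    unfolding orbit_invariant[of q b A i, symmetric] i by (simp add: algebra_simps)
  ultimately have g: "b * b + A * A - 3 * q * b * A \<le> -1" by linarith
  define G H where "G = r * r * (b * b + A * A - 3 * q * b * A)" and "H = b * b * (q * q)"
  have "G \<le> r * r * (-1)" unfolding G_def using g by (intro mult_left_mono) auto
  \<comment> \<open>\<open>r\<^sup>2 h(A, b) - b\<^sup>2 h(s, r)\<close> has the factor \<open>A r - b s\<close>.\<close>
  moreover have "G + H \<ge> 0"
  proof -
    have "b * s - A * r \<ge> 0" using e Bq by linarith
    moreover have "3 * q * (b * r) - (A * r + b * s) \<ge> 0"
    proof -
      have "1 * (b * r) \<le> q * (b * r)" "0 < b * r" using pos b by (auto intro: mult_right_mono)
      then show ?thesis using bs e Bq by linarith
    qed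
    ultimately have "0 \<le> (b * s - A * r) * (3 * q * (b * r) - (A * r + b * s))" by simp
    also have "\<dots> = G - b * b * (s * s + r * r - 3 * q * r * s)" unfolding G_def by (simp add: algebra_simps)
    also have "s * s + r * r - 3 * q * r * s = - (q * q)" using me by simp
    finally show ?thesis unfolding H_def by simp
  qed
  ultimately have "r * r \<le> H" by linarith
  then have "r * r \<le> (q * b) * (q * b)" unfolding H_def by (simp add: mult_ac)
  then have "r \<le> q * b" using pos b by (meson mult_strict_mono not_less less_imp_le mult_pos_pos)
  also have "\<dots> \<le> b * b" using qb b by simp
  finally show ?thesis .
qed

definition markov_pair :: "int \<Rightarrow> int \<Rightarrow> bool" where
  "markov_pair p q \<longleftrightarrow> (\<exists>p1 q1 p3 q3. frac_triple p1 q1 p q p3 q3)"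

lemma markov_pair_minus: "markov_pair p q \<Longrightarrow> markov_pair (- p) q"
  unfolding markov_pair_def using frac_triple_minus by blast

lemma frac_triple_markov_pairs:
  assumes "frac_triple p1 q1 p2 q2 p3 q3"
  shows "markov_pair p1 q1" "markov_pair p2 q2" "markov_pair p3 q3"
  using frac_triple_rotate_back[OF assms] assms frac_triple_rotate[OF assms]
  unfolding markov_pair_def by blast+

text \<open>
  Descent in the Markov tree below a triple whose middle denominator is the largest. The
  descent measure is positive by \<open>outer_denominator_bound\<close> and drops because the sum of the
  outer denominators increases.
\<close>
lemma markov_tree_search:
  assumes b: "b > 0"
    and good: "\<And>c d. d > 0 \<Longrightarrow> a * d \<noteq> b * c \<Longrightarrow> b \<le> 3 * d * \<bar>a * d - b * c\<bar>"
  shows "\<lbrakk>frac_triple p1 q1 p2 q2 p3 q3; q1 < q2; q3 < q2; a * q1 - b * p1 > 0; b * p3 - a * q3 > 0\<rbrakk>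
    \<Longrightarrow> \<exists>p q. markov_pair p q \<and> (a * q = b * p \<or>
          (\<exists>k\<ge>2. orbit q b (a * q - b * p) k = 0 \<or> orbit q b (b * p - a * q) k = 0))"
proof (induction "nat (2 * (b * b) + 1 - q1 - q3)" arbitrary: p1 q1 p2 q2 p3 q3 rule: less_induct)
  case less
  note ft = less.prems(1)
  note pairs = frac_triple_markov_pairs[OF ft]
  have m: "markov_triple q1 q2 q3" and pos: "q1 > 0" "q2 > 0" "q3 > 0"
    using ft by (auto simp: frac_triple_def markov_triple_def)
  have good': "b \<le> 3 * d * \<bar>(- a) * d - b * c\<bar>" if "d > 0" "(- a) * d \<noteq> b * c" for c d
    using good[of d "- c"] that by (simp add: abs_minus_commute algebra_simps abs_if split: if_splits)
  define A B where "A = a * q1 - b * p1" and "B = b * p3 - a * q3"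
  have AB: "A > 0" "B > 0" using less.prems by (auto simp: A_def B_def)
  have dA: "(\<exists>k\<ge>2. orbit q1 b A k = 0) \<or> (\<forall>n. orbit q1 b A n > 0)"
    by (rule gap_dichotomy[OF pos(1) b A_def AB(1) good])
  have dB: "(\<exists>k\<ge>2. orbit q3 b B k = 0) \<or> (\<forall>n. orbit q3 b B n > 0)"
    by (rule gap_dichotomy[OF pos(3) b _ AB(2) good', of "- p3"]) (simp add: B_def)
  show ?case
  proof (cases "(\<exists>k\<ge>2. orbit q1 b A k = 0) \<or> (\<exists>k\<ge>2. orbit q3 b B k = 0)")
    case True
    then show ?thesis using pairs unfolding A_def B_def by blast
  next
    case False
    then have WA: "orbit q1 b A n > 0" and WB: "orbit q3 b B n > 0" for n using dA dB by auto
    define s where "s = 3 * q1 * q3 - q2"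
    have m132: "markov_triple q1 q3 q2"
      using markov_triple_swap[OF markov_triple_rotate[OF markov_triple_rotate[OF m]]] .
    have ms: "markov_triple q1 q3 s" unfolding s_def by (rule markov_triple_vieta[OF m132])
    have e: "A * q3 + B * q1 = b * s"
    proof -
      have "A * q3 + B * q1 = b * (p3 * q1 - p1 * q3)" by (simp add: A_def B_def algebra_simps)
      then show ?thesis using frac_triple_outer_det[OF ft] by (simp add: s_def)
    qed
    have "q1 \<le> b * b \<and> q3 \<le> b * b"
    proof (cases "q1 \<le> q3")
      case True
      have "s \<le> q3" unfolding s_def by (rule markov_vieta_le[OF m132 True less.prems(3)])
      then have "q3 \<le> b * b" by (rule outer_denominator_bound[OF ms True _ AB e WA])
      then show ?thesis using True by simp
    next
      case False
      have "s \<le> q1" using markov_vieta_le[OF markov_triple_swap[OF m132]] False less.prems(2)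
        by (simp add: s_def mult_ac)
      then have "q1 \<le> b * b"
        by (intro outer_denominator_bound[OF markov_triple_swap[OF ms] _ _ AB(2,1) _ WB])
          (use False e in auto)
      then show ?thesis using False by simp
    qed
    then have bound: "q1 + q3 < 2 * (b * b) + 1" by linarith
    have grow: "q2 < 3 * x * q2 - y" if "x > 0" "y < q2" for x y
    proof -
      have "1 * q2 \<le> x * q2" using that pos by (intro mult_right_mono) auto
      then show ?thesis using that pos by linarith
    qed
    consider "a * q2 = b * p2" | "a * q2 - b * p2 > 0" | "b * p2 - a * q2 > 0" by linarith
    then show ?thesis
    proof cases
      case 1
      then show ?thesis using pairs by blast
    next
      case 2
      show ?thesis
        by (rule less.hyps[OF _ frac_triple_right_child[OF ft]])
          (use bound less.prems 2 grow[OF pos(3) less.prems(2)] in auto)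
    next
      case 3
      show ?thesis
        by (rule less.hyps[OF _ frac_triple_left_child[OF ft]])
          (use bound less.prems 3 grow[OF pos(1) less.prems(3)] in auto)
    qed
  qed
qed

text \<open>
  The search starts at the triple \<open>n\<close>, \<open>n + 1/2\<close>, \<open>n + 1\<close> of denominators \<open>1, 2, 1\<close> around \<open>a / b\<close>.
\<close>
lemma badly_approximable_classification:
  assumes b: "b > 0"
    and good: "\<And>c d. d > 0 \<Longrightarrow> a * d \<noteq> b * c \<Longrightarrow> b \<le> 3 * d * \<bar>a * d - b * c\<bar>"
  shows "\<exists>p q. markov_pair p q \<and> (a * q = b * p \<or>
          (\<exists>k\<ge>2. orbit q b (a * q - b * p) k = 0 \<or> orbit q b (b * p - a * q) k = 0))"
proof -
  define n where "n = a div b"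
  have ft: "frac_triple n 1 (2 * n + 1) 2 (n + 1) 1"
    by (auto simp: frac_triple_def markov_triple_def)
  have a: "a = b * n + a mod b" by (simp add: n_def)
  have r: "0 \<le> a mod b" "a mod b < b" using b by auto
  show ?thesis
  proof (cases "a mod b = 0")
    case True
    then show ?thesis using a frac_triple_markov_pairs(1)[OF ft] by (metis add.right_neutral mult.right_neutral)
  next
    case False
    have "a * 1 - b * n > 0" "b * (n + 1) - a * 1 > 0" using a r False by (auto simp: algebra_simps)
    then show ?thesis using markov_tree_search[OF b good ft] by simp
  qed
qed

section \<open>From integer inequalities to the approximation constant\<close>

lemma approx_const_term:
  fixes P R a b :: int
  assumes "R > 0" "b > 0"
  shows "(real_of_int b)\<^sup>2 * \<bar>real_of_int P / of_int R - of_int a / of_int b\<bar>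
       = of_int (b * \<bar>P * b - a * R\<bar>) / of_int R"
proof -
  have "real_of_int P / of_int R - of_int a / of_int b = of_int (P * b - a * R) / (of_int R * of_int b)"
    using assms by (simp add: field_simps)
  then show ?thesis using assms by (simp add: abs_mult power2_eq_square field_simps)
qed

lemma of_int_divide_eq_iff_cross:
  fixes P R a b :: int
  assumes "R > 0" "b > 0"
  shows "real_of_int P / of_int R = of_int a / of_int b \<longleftrightarrow> P * b = a * R"
proof -
  have "real_of_int P / of_int R = of_int a / of_int b \<longleftrightarrow> real_of_int (P * b) = of_int (a * R)"
    using assms by (simp add: field_simps)
  then show ?thesis by (simp only: of_int_eq_iff)
qed

lemma approx_const_greatest:
  assumes R: "R > 0"
    and le: "\<And>a b. b > 0 \<Longrightarrow> a * R \<noteq> P * b \<Longrightarrow> c * of_int R \<le> of_int (b * \<bar>P * b - a * R\<bar>)"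
  shows "c \<le> approx_const (of_int P / of_int R)"
  unfolding approx_const_def
proof (rule cInf_greatest)
  let ?n = "P div R + 1"
  have "P < ?n * R"
  proof -
    have "P = R * (P div R) + P mod R" "P mod R < R" using R by simp_all
    moreover have "?n * R = R * (P div R) + R" by (simp add: algebra_simps)
    ultimately show ?thesis by linarith
  qed
  then have "real_of_int P / of_int R \<noteq> of_int ?n / of_int 1"
    using of_int_divide_eq_iff_cross[OF R, of 1 P ?n] by simp
  then show "{(real_of_int b)\<^sup>2 * \<bar>real_of_int P / of_int R - of_int a / of_int b\<bar> |a b.
     0 < b \<and> coprime a b \<and> real_of_int P / of_int R \<noteq> of_int a / of_int b} \<noteq> {}"
    using coprime_1_right zero_less_one by blast
next
  fix x
  assume "x \<in> {(real_of_int b)\<^sup>2 * \<bar>real_of_int P / of_int R - of_int a / of_int b\<bar> |a b.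
     0 < b \<and> coprime a b \<and> real_of_int P / of_int R \<noteq> of_int a / of_int b}"
  then obtain a b where ab: "0 < b" "real_of_int P / of_int R \<noteq> of_int a / of_int b"
    and x: "x = (real_of_int b)\<^sup>2 * \<bar>real_of_int P / of_int R - of_int a / of_int b\<bar>" by blast
  have "a * R \<noteq> P * b" using ab of_int_divide_eq_iff_cross[OF R ab(1), of P a] by auto
  then have "c * of_int R \<le> of_int (b * \<bar>P * b - a * R\<bar>)" using le ab by blast
  then show "c \<le> x" unfolding x approx_const_term[OF R ab(1)] using R by (simp add: pos_le_divide_eq)
qed

text \<open>
  Passing to the reduced form of \<open>a / b\<close> only makes the product smaller.
\<close>
lemma approx_const_lower:
  assumes R: "R > 0" and b: "b > 0" and ne: "P * b \<noteq> a * R"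
  shows "approx_const (of_int P / of_int R) \<le> of_int (b * \<bar>P * b - a * R\<bar>) / of_int R"
proof -
  define g a' b' where "g = gcd a b" and "a' = a div g" and "b' = b div g"
  have g: "g > 0" using b by (simp add: g_def)
  have ab: "a = g * a'" "b = g * b'" by (simp_all add: g_def a'_def b'_def)
  have cop: "coprime a' b'" using b unfolding a'_def b'_def g_def by (intro div_gcd_coprime) auto
  have b': "b' > 0" using b g ab by (metis zero_less_mult_pos)
  have ne': "P * b' \<noteq> a' * R" using ne unfolding ab by auto
  have "approx_const (of_int P / of_int R)
      \<le> (real_of_int b')\<^sup>2 * \<bar>real_of_int P / of_int R - of_int a' / of_int b'\<bar>"
    unfolding approx_const_def
  proof (rule cInf_lower)
    show "bdd_below {(real_of_int b)\<^sup>2 * \<bar>real_of_int P / of_int R - of_int a / of_int b\<bar> |a b.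
       0 < b \<and> coprime a b \<and> real_of_int P / of_int R \<noteq> of_int a / of_int b}"
      by (rule bdd_belowI[of _ 0]) auto
  qed (use cop b' ne' of_int_divide_eq_iff_cross[OF R b'] in blast)
  also have "\<dots> = of_int (b' * \<bar>P * b' - a' * R\<bar>) / of_int R" by (rule approx_const_term[OF R b'])
  also have "\<dots> \<le> of_int (b * \<bar>P * b - a * R\<bar>) / of_int R"
  proof -
    have "b * \<bar>P * b - a * R\<bar> = g * g * (b' * \<bar>P * b' - a' * R\<bar>)"
    proof -
      have "P * b - a * R = g * (P * b' - a' * R)" unfolding ab by (simp add: algebra_simps)
      then show ?thesis using g ab(2) by (simp add: abs_mult)
    qed
    moreover have "1 * (b' * \<bar>P * b' - a' * R\<bar>) \<le> (g * g) * (b' * \<bar>P * b' - a' * R\<bar>)"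
      using g b' by (intro mult_right_mono) (auto simp: int_one_le_iff_zero_less)
    ultimately have "b' * \<bar>P * b' - a' * R\<bar> \<le> b * \<bar>P * b - a * R\<bar>" by linarith
    then have "real_of_int (b' * \<bar>P * b' - a' * R\<bar>) \<le> of_int (b * \<bar>P * b - a * R\<bar>)"
      by (simp only: of_int_le_iff)
    then show ?thesis using R by (intro divide_right_mono) auto
  qed
  finally show ?thesis .
qed

lemma approx_const_ge_third_iff:
  assumes R: "R > 0"
  shows "1 / 3 \<le> approx_const (of_int P / of_int R) \<longleftrightarrow>
    (\<forall>a b. b > 0 \<longrightarrow> a * R \<noteq> P * b \<longrightarrow> R \<le> 3 * b * \<bar>P * b - a * R\<bar>)"
proof (intro iffI allI impI)
  fix a b :: int assume "1 / 3 \<le> approx_const (of_int P / of_int R)" "b > 0" "a * R \<noteq> P * b"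
  then have "1 / 3 \<le> real_of_int (b * \<bar>P * b - a * R\<bar>) / of_int R"
    using approx_const_lower[OF R, of b P a] by linarith
  then have "real_of_int R \<le> of_int (3 * b * \<bar>P * b - a * R\<bar>)" using R by (simp add: field_simps)
  then show "R \<le> 3 * b * \<bar>P * b - a * R\<bar>" by (simp only: of_int_le_iff)
next
  assume *: "\<forall>a b. b > 0 \<longrightarrow> a * R \<noteq> P * b \<longrightarrow> R \<le> 3 * b * \<bar>P * b - a * R\<bar>"
  show "1 / 3 \<le> approx_const (of_int P / of_int R)"
  proof (rule approx_const_greatest[OF R])
    fix a b :: int assume "b > 0" "a * R \<noteq> P * b"
    then have "R \<le> 3 * (b * \<bar>P * b - a * R\<bar>)" using * by (simp add: mult.assoc)
    then have "real_of_int R \<le> of_int (3 * (b * \<bar>P * b - a * R\<bar>))" by (simp only: of_int_le_iff)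
    then show "1 / 3 * real_of_int R \<le> of_int (b * \<bar>P * b - a * R\<bar>)" by simp
  qed
qed

text \<open>
  A strict bound for each fraction survives the infimum, because all terms are integer multiples
  of \<open>1 / R\<close>.
\<close>
lemma approx_const_gt_third:
  assumes R: "R > 0"
    and gt: "\<And>a b. b > 0 \<Longrightarrow> a * R \<noteq> P * b \<Longrightarrow> R < 3 * b * \<bar>P * b - a * R\<bar>"
  shows "1 / 3 < approx_const (of_int P / of_int R)"
proof -
  have "(of_int R + 1) / (3 * of_int R) \<le> approx_const (of_int P / of_int R)"
  proof (rule approx_const_greatest[OF R])
    fix a b :: int assume "b > 0" "a * R \<noteq> P * b"
    then have "R + 1 \<le> 3 * (b * \<bar>P * b - a * R\<bar>)" using gt[of b a] by (simp add: mult.assoc)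
    then have "real_of_int (R + 1) \<le> of_int (3 * (b * \<bar>P * b - a * R\<bar>))" by (simp only: of_int_le_iff)
    then show "(real_of_int R + 1) / (3 * real_of_int R) * real_of_int R \<le> of_int (b * \<bar>P * b - a * R\<bar>)"
      using R by simp
  qed
  moreover have "1 / 3 < (real_of_int R + 1) / (3 * of_int R)" using R by (simp add: field_simps)
  ultimately show ?thesis by linarith
qed

lemma markov_pair_pos: "markov_pair p q \<Longrightarrow> q > 0"
  by (auto simp: markov_pair_def frac_triple_def markov_triple_def)

lemma markov_fraction_iff:
  "markov_fraction x \<longleftrightarrow> (\<exists>p q. markov_pair p q \<and> x = of_int p / of_int q)"
proof
  assume "markov_fraction x"
  then obtain q1 q2 q3 p1 p2 p3 where ft: "frac_triple p1 q1 p2 q2 p3 q3"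
    and "x \<in> {of_int p1 / of_int q1, of_int p2 / of_int q2, of_int p3 / of_int q3}"
    unfolding markov_fraction_def rational_markov_triple_def frac_triple_def by blast
  then show "\<exists>p q. markov_pair p q \<and> x = of_int p / of_int q"
    using frac_triple_markov_pairs[OF ft] by blast
next
  assume "\<exists>p q. markov_pair p q \<and> x = of_int p / of_int q"
  then show "markov_fraction x"
    unfolding markov_fraction_def rational_markov_triple_def frac_triple_def markov_pair_def by blast
qed

lemma reduced_denom_markov:
  assumes "markov_pair p q" shows "reduced_denom (of_int p / of_int q) = q"
proof -
  have "coprime p q" using assms frac_triple_coprime by (auto simp: markov_pair_def)
  then have "quotient_of (Fract p q) = (p, q)"
    using markov_pair_pos[OF assms] by (simp add: quotient_of_Fract normalize_stable)
  then show ?thesis by (simp add: reduced_denom_def Fract_of_int_quotient)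
qed

lemma right_companion_eq:
  assumes m: "markov_pair p q" and k: "k \<ge> 1"
  shows "right_companion (Suc k) (of_int p / of_int q) =
    of_int (p * companion_seq q (Suc k) + companion_seq q k) / of_int (q * companion_seq q (Suc k))"
proof -
  have q: "q > 0" by (rule markov_pair_pos[OF m])
  then have "companion_seq q (Suc k) > 0" using companion_seq_growth by blast
  then show ?thesis using q unfolding right_companion_def reduced_denom_markov[OF m]
    by (simp add: field_simps)
qed

lemma left_companion_minus:
  assumes m: "markov_pair p q"
  shows "left_companion k (of_int p / of_int q) = - right_companion k (of_int (- p) / of_int q)"
  unfolding right_companion_def left_companion_def reduced_denom_markov[OF m]
    reduced_denom_markov[OF markov_pair_minus[OF m]] by simp

lemma approx_const_minus: "approx_const (- x) = approx_const x"
proof -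
  have sub: "{(of_int b)\<^sup>2 * \<bar>- x - of_int a / of_int b\<bar> | a b :: int.
      b > 0 \<and> coprime a b \<and> - x \<noteq> of_int a / of_int b}
    \<subseteq> {(of_int b)\<^sup>2 * \<bar>x - of_int a / of_int b\<bar> | a b :: int.
      b > 0 \<and> coprime a b \<and> x \<noteq> of_int a / of_int b}" for x :: real
  proof clarify
    fix a b :: int assume "b > 0" "coprime a b" "- x \<noteq> of_int a / of_int b"
    then show "\<exists>a' b'. (of_int b)\<^sup>2 * \<bar>- x - of_int a / of_int b\<bar> = (of_int b')\<^sup>2 * \<bar>x - of_int a' / of_int b'\<bar> \<and>
      0 < b' \<and> coprime a' b' \<and> x \<noteq> of_int a' / of_int b'"
      by (intro exI[of _ "- a"] exI[of _ b]) (auto simp: abs_if)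
  qed
  show ?thesis unfolding approx_const_def using sub[of x] sub[of "- x"] by (simp add: subset_antisym)
qed

lemma approx_const_markov:
  assumes "markov_pair p q"
  shows "approx_const (of_int p / of_int q) > 1 / 3"
proof (rule approx_const_gt_third)
  show "q > 0" by (rule markov_pair_pos[OF assms])
  fix a b :: int assume "b > 0" "a * q \<noteq> p * b"
  then have "q < 3 * b * \<bar>a * q - b * p\<bar>"
    using assms frac_triple_bound by (force simp: markov_pair_def mult.commute)
  then show "q < 3 * b * \<bar>p * b - a * q\<bar>" by (simp add: abs_minus_commute mult.commute)
qed

text \<open>
  With \<open>k = 1\<close> the upper bound comes from the approximation \<open>p / q\<close> at distance \<open>1 / (3 q\<^sup>2)\<close>.
\<close>
lemma approx_const_right_companion:
  assumes m: "markov_pair p q" and k: "k \<ge> 1"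
  defines "y \<equiv> right_companion (Suc k) (of_int p / of_int q)"
  shows "if k = 1 then approx_const (of_rat y) = 1 / 3 else approx_const (of_rat y) > 1 / 3"
proof -
  let ?u = "companion_seq q"
  define P R where "P = p * ?u (Suc k) + ?u k" and "R = q * ?u (Suc k)"
  have q: "q > 0" by (rule markov_pair_pos[OF m])
  have u: "?u (Suc k) > 0" using companion_seq_growth[OF q] by blast
  have R: "R > 0" using q u by (simp add: R_def)
  have y: "of_rat y = real_of_int P / of_int R"
    unfolding y_def right_companion_eq[OF m k] P_def R_def by (simp only: of_rat_divide of_rat_of_int_eq)
  have W: "a * R - P * b = orbit q b (a * q - b * p) (Suc k)" for a b
    using orbit_shift[of q b "a * q - b * p" 0 k] by (simp add: P_def R_def algebra_simps)
  have bnd: "R \<le> 3 * b * \<bar>P * b - a * R\<bar> \<and> (k \<ge> 2 \<longrightarrow> R < 3 * b * \<bar>P * b - a * R\<bar>)"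
    if b: "b > 0" and ne: "a * R \<noteq> P * b" for a b
  proof -
    obtain p1 q1 p3 q3 where ft: "frac_triple p1 q1 p q p3 q3" using m by (auto simp: markov_pair_def)
    have "orbit q b (a * q - b * p) (Suc k) \<noteq> 0" using W[of a b] ne by auto
    from companion_bound_right[OF ft b k refl this] show ?thesis
      unfolding W[symmetric] R_def[symmetric] by (simp add: abs_minus_commute)
  qed
  show ?thesis
  proof (cases "k = 1")
    case True
    have "1 / 3 \<le> approx_const (of_int P / of_int R)"
      unfolding approx_const_ge_third_iff[OF R] using bnd by blast
    moreover have d: "P * q - p * R = q" using True by (simp add: P_def R_def algebra_simps)
    have "approx_const (of_int P / of_int R) \<le> of_int (q * \<bar>P * q - p * R\<bar>) / of_int R"
      by (rule approx_const_lower[OF R q]) (use d q in auto)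
    moreover have "real_of_int (q * \<bar>P * q - p * R\<bar>) / of_int R = 1 / 3"
      unfolding d using q True by (simp add: R_def)
    ultimately have "approx_const (of_int P / of_int R) = 1 / 3" by linarith
    then show ?thesis unfolding y using True by simp
  next
    case False
    then have "1 / 3 < approx_const (of_int P / of_int R)"
      using k bnd by (intro approx_const_gt_third[OF R]) auto
    then show ?thesis unfolding y using False by simp
  qed
qed

lemma approx_const_left_companion:
  assumes m: "markov_pair p q" and k: "k \<ge> 1"
  defines "y \<equiv> left_companion (Suc k) (of_int p / of_int q)"
  shows "if k = 1 then approx_const (of_rat y) = 1 / 3 else approx_const (of_rat y) > 1 / 3"
  using approx_const_right_companion[OF markov_pair_minus[OF m] k]
  unfolding y_def left_companion_minus[OF m] of_rat_minus approx_const_minus .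

lemma orbit_zero_right_companion:
  assumes m: "markov_pair p q" and b: "b > 0" and k: "k \<ge> 2" and z: "orbit q b (a * q - b * p) k = 0"
  shows "of_int a / of_int b = right_companion k (of_int p / of_int q)"
proof -
  obtain i where i: "k = Suc i" "i \<ge> 1" using k by (cases k) auto
  let ?u = "companion_seq q"
  have q: "q > 0" by (rule markov_pair_pos[OF m])
  have u: "?u (Suc i) > 0" using companion_seq_growth[OF q] by blast
  have "a * (q * ?u (Suc i)) = (p * ?u (Suc i) + ?u i) * b"
    using orbit_shift[of q b "a * q - b * p" 0 i] z i by (simp add: algebra_simps)
  then have "(of_int (a * (q * ?u (Suc i))) :: rat) = of_int ((p * ?u (Suc i) + ?u i) * b)" by (simp only:)
  then have "(of_int a :: rat) * of_int (q * ?u (Suc i)) = of_int (p * ?u (Suc i) + ?u i) * of_int b"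
    by (simp only: of_int_mult)
  moreover have "(of_int b :: rat) \<noteq> 0" "(of_int (q * ?u (Suc i)) :: rat) \<noteq> 0"
    using b q u by simp_all
  ultimately show ?thesis unfolding i(1) right_companion_eq[OF m i(2)]
    using frac_eq_eq by blast
qed

lemma approx_const_ge_third_cases:
  assumes "1 / 3 \<le> approx_const (of_rat y)"
  obtains p q where "markov_pair p q" "y = of_int p / of_int q"
  | p q k where "markov_pair p q" "k \<ge> 1" "y = right_companion (Suc k) (of_int p / of_int q)"
  | p q k where "markov_pair p q" "k \<ge> 1" "y = left_companion (Suc k) (of_int p / of_int q)"
proof -
  obtain a b where ab: "quotient_of y = (a, b)" by fastforce
  have b: "b > 0" using quotient_of_denom_pos[OF ab] .
  have y: "y = of_int a / of_int b" by (rule quotient_of_div[OF ab])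
  have "of_rat y = real_of_int a / of_int b" unfolding y by (simp only: of_rat_divide of_rat_of_int_eq)
  then have "\<forall>c d. d > 0 \<longrightarrow> c * b \<noteq> a * d \<longrightarrow> b \<le> 3 * d * \<bar>a * d - c * b\<bar>"
    using assms approx_const_ge_third_iff[OF b, of a] by simp
  then have "b \<le> 3 * d * \<bar>a * d - b * c\<bar>" if "d > 0" "a * d \<noteq> b * c" for c d
    using that by (metis mult.commute)
  from badly_approximable_classification[OF b this] obtain p q where m: "markov_pair p q"
    and or: "a * q = b * p \<or> (\<exists>k\<ge>2. orbit q b (a * q - b * p) k = 0 \<or> orbit q b (b * p - a * q) k = 0)"
    by blast
  have q: "q > 0" by (rule markov_pair_pos[OF m])
  from or consider "a * q = b * p"
    | k where "k \<ge> 2" "orbit q b (a * q - b * p) k = 0"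
    | k where "k \<ge> 2" "orbit q b ((- a) * q - b * (- p)) k = 0" by (auto simp: algebra_simps)
  then show ?thesis
  proof cases
    case 1
    then have "(of_int (a * q) :: rat) = of_int (b * p)" by (simp only:)
    then have "y = of_int p / of_int q" unfolding y using b q by (simp add: field_simps)
    then show ?thesis using that(1) m by blast
  next
    case (2 k)
    then have "y = right_companion k (of_int p / of_int q)"
      unfolding y by (intro orbit_zero_right_companion[OF m b])
    then show ?thesis using that(2)[OF m, of "k - 1"] 2 by simp
  next
    case (3 k)
    then have "- y = right_companion k (of_int (- p) / of_int q)"
      unfolding y using orbit_zero_right_companion[OF markov_pair_minus[OF m] b 3] by simp
    then have "y = left_companion k (of_int p / of_int q)"
      unfolding left_companion_minus[OF m] by (metis minus_minus)
    then show ?thesis using that(3)[OF m, of "k - 1"] 3 by simp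
  qed
qed

theorem theorem2p2:
  fixes y :: rat
  shows "(approx_const (of_rat y) \<ge> 1 / 3 \<longleftrightarrow>
            markov_fraction y \<or> (\<exists>x. markov_fraction x \<and> companion_of y x))
       \<and> (approx_const (of_rat y) = 1 / 3 \<longleftrightarrow>
            (\<exists>x. markov_fraction x \<and> (y = right_companion 2 x \<or> y = left_companion 2 x)))"
proof (intro conjI iffI)
  assume "approx_const (of_rat y) \<ge> 1 / 3"
  then show "markov_fraction y \<or> (\<exists>x. markov_fraction x \<and> companion_of y x)"
  proof (cases rule: approx_const_ge_third_cases)
    case (2 p q k)
    then have "companion_of y (of_int p / of_int q)"
      unfolding companion_of_def by (intro exI[of _ "Suc k"]) auto
    then show ?thesis using 2 markov_fraction_iff by blast
  next
    case (3 p q k)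
    then have "companion_of y (of_int p / of_int q)"
      unfolding companion_of_def by (intro exI[of _ "Suc k"]) auto
    then show ?thesis using 3 markov_fraction_iff by blast
  qed (use markov_fraction_iff in blast)
next
  assume "markov_fraction y \<or> (\<exists>x. markov_fraction x \<and> companion_of y x)"
  then consider p q where "markov_pair p q" "y = of_int p / of_int q"
    | p q k where "markov_pair p q" "k \<ge> 2"
        "y = right_companion k (of_int p / of_int q) \<or> y = left_companion k (of_int p / of_int q)"
    unfolding markov_fraction_iff companion_of_def by blast
  then show "approx_const (of_rat y) \<ge> 1 / 3"
  proof cases
    case 1
    then show ?thesis using approx_const_markov[OF 1(1)]
      by (simp add: of_rat_divide)
  next
    case (2 p q k)
    then obtain i where "k = Suc i" "i \<ge> 1" by (cases k) auto
    then show ?thesis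
      using 2 approx_const_right_companion[OF 2(1), of i] approx_const_left_companion[OF 2(1), of i]
      by (auto split: if_splits)
  qed
next
  assume eq: "approx_const (of_rat y) = 1 / 3"
  then have "approx_const (of_rat y) \<ge> 1 / 3" by simp
  then show "\<exists>x. markov_fraction x \<and> (y = right_companion 2 x \<or> y = left_companion 2 x)"
  proof (cases rule: approx_const_ge_third_cases)
    case (1 p q)
    then show ?thesis using approx_const_markov[OF 1(1)] eq by (simp add: of_rat_divide)
  next
    case (2 p q k)
    then have "k = 1" using approx_const_right_companion[OF 2(1,2)] eq by (auto split: if_splits)
    then show ?thesis using 2 markov_fraction_iff by (auto simp: numeral_2_eq_2)
  next
    case (3 p q k)
    then have "k = 1" using approx_const_left_companion[OF 3(1,2)] eq by (auto split: if_splits)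
    then show ?thesis using 3 markov_fraction_iff by (auto simp: numeral_2_eq_2)
  qed
next
  assume "\<exists>x. markov_fraction x \<and> (y = right_companion 2 x \<or> y = left_companion 2 x)"
  then obtain p q where "markov_pair p q"
    "y = right_companion (Suc 1) (of_int p / of_int q) \<or> y = left_companion (Suc 1) (of_int p / of_int q)"
    unfolding markov_fraction_iff by (auto simp: numeral_2_eq_2)
  then show "approx_const (of_rat y) = 1 / 3"
    using approx_const_right_companion[of p q 1] approx_const_left_companion[of p q 1] by auto
qed

end
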